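(* Let $K$ be a field and $S=K[x_1,\ldots,x_n]$. If $I\subsetneq J\subset S$ are two monomial complete intersection ideals, then $\operatorname{sdepth}_S(J/I)\geq \operatorname{depth}_S(J/I)$.
   Context: A monomial complete intersection ideal of $S$ is an ideal generated by monomials forming a regular sequence on $S$ (the zero ideal, generated by the empty sequence, is allowed). Let $S=K[x_1,\ldots,x_n]$ with its standard $\mathbb Z^n$-grading and let $M\neq 0$ be a $\mathbb Z^n$-graded $S$-module. A Stanley decomposition of $M$ is a finite direct sum decomposition $\mathcal D: M=\bigoplus_{i=1}^r m_iK[Z_i]$ as a $\mathbb Z^n$-graded $K$-vector space, where each $m_i\in M$ is homogeneous with respect to the $\mathbb Z^n$-grading, $Z_i\subset\{x_1,\ldots,x_n\}$, and $m_iK[Z_i]=\{um_i: u\in K[Z_i]\}\subset M$ is a free $K[Z_i]$-submodule of $M$. Put $\operatorname{sdepth}(\mathcal D)=\min_{i}|Z_i|$ and $\operatorname{sdepth}_S(M)=\max\{\operatorname{sdepth}(\mathcal D): \mathcal D \text{ is a Stanley decomposition of } M\}$; this is the Stanley depth of $M$. *)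

theory Defs
  imports
    "HOL-Algebra.QuotRing"
    "HOL-Algebra.Module"
    "HOL-Library.Poly_Mapping"
    "HOL-Library.Extended_Nat"
begin

section \<open>The polynomial ring\<close>

text \<open>The variables are indexed by a finite type \<open>'n\<close>, so that \<open>n = CARD('n)\<close>; an exponent vector is
  an element of \<open>'n \<Rightarrow>\<^sub>0 nat\<close>, and the multiplication of \<^theory>\<open>HOL-Library.Poly_Mapping\<close> is the
  convolution product, i.e. the multiplication of polynomials.\<close>

type_synonym ('n, 'k) mpol = "('n \<Rightarrow>\<^sub>0 nat) \<Rightarrow>\<^sub>0 'k"

text \<open>The field \<open>smult\<close> lets the same record serve as the ring \<open>S\<close> and as \<open>S\<close> regarded as a module
  over itself.\<close>

definition polyring :: "(('n::finite, 'k::field) mpol, ('n, 'k) mpol) module" where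
  "polyring = \<lparr>carrier = UNIV, monoid.mult = (*), one = 1, ring.zero = 0, add = (+), smult = (*)\<rparr>"

definition monomial :: "('n \<Rightarrow>\<^sub>0 nat) \<Rightarrow> ('n, 'k::field) mpol" where
  "monomial a = Poly_Mapping.single a 1"

definition var :: "'n \<Rightarrow> ('n, 'k::field) mpol" where
  "var i = monomial (Poly_Mapping.single i 1)"

definition max_graded_ideal :: "('n::finite, 'k::field) mpol set" where
  "max_graded_ideal = Idl\<^bsub>polyring\<^esub> (range var)"

text \<open>The subalgebra \<open>K[Z]\<close>.\<close>

definition subpoly :: "'n set \<Rightarrow> ('n, 'k::field) mpol set" where
  "subpoly Z = {u. \<forall>a\<in>Poly_Mapping.keys u. Poly_Mapping.keys a \<subseteq> Z}"

text \<open>The component of \<open>S\<close> of degree \<open>a\<close>; it is zero if \<open>a\<close> has a negative entry.\<close>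

definition poly_component :: "('n \<Rightarrow> int) \<Rightarrow> ('n, 'k::field) mpol set" where
  "poly_component a = {f. \<forall>b\<in>Poly_Mapping.keys f. \<forall>i. int (Poly_Mapping.lookup b i) = a i}"


section \<open>Regular sequences and depth\<close>

text \<open>The submodule \<open>(x\<^sub>1, \<dots>, x\<^sub>k) M\<close>.\<close>

definition seq_submodule ::
  "('r, 'm, 'c) module_scheme \<Rightarrow> 'r list \<Rightarrow> 'm set" where
  "seq_submodule M xs =
     {(\<Oplus>\<^bsub>M\<^esub>i\<in>{..<length xs}. (xs ! i) \<odot>\<^bsub>M\<^esub> v i) | v. v \<in> {..<length xs} \<rightarrow> carrier M}"

text \<open>\<open>x\<^sub>i\<close> is a nonzerodivisor on \<open>M / (x\<^sub>1, \<dots>, x\<^bsub>i-1\<^esub>) M\<close> for all \<open>i\<close>, and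
  \<open>M / (x\<^sub>1, \<dots>, x\<^sub>k) M\<close> is nonzero.\<close>

definition regular_sequence ::
  "('r, 'b) ring_scheme \<Rightarrow> ('r, 'm, 'c) module_scheme \<Rightarrow> 'r list \<Rightarrow> bool" where
  "regular_sequence R M xs \<longleftrightarrow>
     set xs \<subseteq> carrier R \<and>
     (\<forall>i<length xs. \<forall>v\<in>carrier M.
        (xs ! i) \<odot>\<^bsub>M\<^esub> v \<in> seq_submodule M (take i xs) \<longrightarrow> v \<in> seq_submodule M (take i xs)) \<and>
     seq_submodule M xs \<noteq> carrier M"

definition grade ::
  "('r, 'b) ring_scheme \<Rightarrow> 'r set \<Rightarrow> ('r, 'm, 'c) module_scheme \<Rightarrow> enat" where
  "grade R Q M = (SUP xs \<in> {xs. set xs \<subseteq> Q \<and> regular_sequence R M xs}. enat (length xs))"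

definition depth :: "(('n::finite, 'k::field) mpol, 'm, 'c) module_scheme \<Rightarrow> enat" where
  "depth M = grade polyring max_graded_ideal M"


section \<open>Stanley decompositions\<close>

text \<open>The grading of \<open>M\<close> is passed as its family \<open>gr\<close> of components. A summand \<open>m K[Z]\<close> is
  represented by the pair \<open>(m, Z)\<close>.\<close>

definition stanley_space ::
  "(('n::finite, 'k::field) mpol, 'm, 'c) module_scheme \<Rightarrow> 'm \<times> 'n set \<Rightarrow> 'm set" where
  "stanley_space M p = (\<lambda>u. u \<odot>\<^bsub>M\<^esub> fst p) ` subpoly (snd p)"

text \<open>The second conjunct says that \<open>m K[Z]\<close> is free over \<open>K[Z]\<close> with basis \<open>m\<close>; the last one that
  \<open>M\<close> is the direct sum of the spaces. Since every \<open>m\<close> is homogeneous, so is every \<open>m x\<^sup>a\<close>, and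
  each \<open>m K[Z]\<close> is automatically a graded subspace.\<close>

definition stanley_decomposition ::
  "(('n::finite, 'k::field) mpol, 'm, 'c) module_scheme \<Rightarrow> (('n \<Rightarrow> int) \<Rightarrow> 'm set) \<Rightarrow>
   ('m \<times> 'n set) list \<Rightarrow> bool" where
  "stanley_decomposition M gr D \<longleftrightarrow>
     (\<forall>(m, Z)\<in>set D. m \<in> carrier M \<and> (\<exists>a. m \<in> gr a)) \<and>
     (\<forall>(m, Z)\<in>set D. \<forall>u\<in>subpoly Z. u \<odot>\<^bsub>M\<^esub> m = \<zero>\<^bsub>M\<^esub> \<longrightarrow> u = 0) \<and>
     (\<forall>v\<in>carrier M. \<exists>!w. w \<in> (\<Pi>\<^sub>E i\<in>{..<length D}. stanley_space M (D ! i)) \<and>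
        v = (\<Oplus>\<^bsub>M\<^esub>i\<in>{..<length D}. w i))"

definition sdepth_decomposition :: "('m \<times> 'n::finite set) list \<Rightarrow> nat" where
  "sdepth_decomposition D = Min ((\<lambda>(m, Z). card Z) ` set D)"

definition sdepth ::
  "(('n::finite, 'k::field) mpol, 'm, 'c) module_scheme \<Rightarrow> (('n \<Rightarrow> int) \<Rightarrow> 'm set) \<Rightarrow> nat" where
  "sdepth M gr = Max {sdepth_decomposition D | D. stanley_decomposition M gr D}"


section \<open>Monomial complete intersections and their quotients\<close>

definition monomial_complete_intersection :: "('n::finite, 'k::field) mpol set \<Rightarrow> bool" where
  "monomial_complete_intersection I \<longleftrightarrow>
     (\<exists>us. set us \<subseteq> range monomial \<and> regular_sequence polyring polyring us \<and>
           I = Idl\<^bsub>polyring\<^esub> (set us))"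

text \<open>The module \<open>J / I\<close> for ideals \<open>I \<subseteq> J\<close> of \<open>R\<close>. Its elements are the cosets \<open>I + f\<close> with
  \<open>f \<in> J\<close>; \<open>r\<close> sends \<open>I + f\<close> to \<open>I + r f\<close>. The fields \<open>mult\<close> and \<open>one\<close> of the record
  have no meaning for a module and are filled in as for \<open>R Quot I\<close>.\<close>

definition quotient_module ::
  "('r, 'b) ring_scheme \<Rightarrow> 'r set \<Rightarrow> 'r set \<Rightarrow> ('r, 'r set) module" where
  "quotient_module R J I =
     \<lparr>carrier = (\<lambda>f. I +>\<^bsub>R\<^esub> f) ` J,
      monoid.mult = rcoset_mult R I,
      one = I +>\<^bsub>R\<^esub> \<one>\<^bsub>R\<^esub>,
      ring.zero = I,
      add = set_add R,
      smult = (\<lambda>r A. \<Union>x\<in>A. I +>\<^bsub>R\<^esub> (r \<otimes>\<^bsub>R\<^esub> x))\<rparr>"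

definition quotient_component ::
  "('n::finite, 'k::field) mpol set \<Rightarrow> ('n, 'k) mpol set \<Rightarrow> ('n \<Rightarrow> int) \<Rightarrow> ('n, 'k) mpol set set"
  where "quotient_component J I a = (\<lambda>f. I +>\<^bsub>polyring\<^esub> f) ` (J \<inter> poly_component a)"

end

theory Submission
  imports Defs "HOL-Library.Disjoint_Sets"
begin

text \<open>
  Let \<open>I\<close> be generated by the pairwise coprime monomials in \<open>A\<close>, let \<open>J\<close> be generated by those in \<open>B\<close>,
  and put \<open>c = max |A| (|B| - 1)\<close>. Every element of \<open>A\<close> is a multiple of an element of \<open>B\<close>, and as the
  elements of \<open>A\<close> are coprime, different ones are multiples of different elements of \<open>B\<close>
  (\<open>divisor_assignment\<close>). The theorem follows from
  \<open>depth (J/I) \<le> n - c \<le> sdepth (J/I)\<close>.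

  The second inequality is combinatorial. The monomials in \<open>J\<close> but not in \<open>I\<close> have to be partitioned into
  cones, that is, sets of monomials of the form \<open>x\<^sup>a K[Z]\<close>. Removing the multiples of a monomial from a
  cone leaves a disjoint union of cones of dimension smaller by at most one
  (\<open>cone_decomposable_remove_one\<close>). Number the generators so that \<open>v\<^sub>i\<close> divides \<open>u\<^sub>i\<close>. The monomials whose
  first divisor among the \<open>v\<^sub>i\<close> is \<open>v\<^sub>k\<close> arise from the full cone of \<open>v\<^sub>k\<close> by removing the multiples
  of the \<open>v\<^sub>i\<close> with \<open>i < k\<close> and of the \<open>u\<^sub>i\<close> with \<open>i \<ge> k\<close>, which are at most \<open>c\<close> monomials
  (\<open>cone_decomposable_difference_lists\<close>).

  For the first inequality, a regular sequence of length \<open>l\<close> on \<open>J/I\<close> consisting of elements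
  \<open>f = \<Sum> g\<^sub>a x\<^sub>a\<close> forces the Koszul homology \<open>H\<^sub>p(x\<^sub>1, \<dots>, x\<^sub>n; J/I)\<close> to vanish for \<open>p > n - l\<close>, by a
  direct argument with the homotopy between multiplication by \<open>f\<close> and zero
  (\<open>koszul_exact_descend\<close>, \<open>koszul_exact_of_regular\<close>). So it is enough to find a nonzero class in degree
  \<open>c\<close>. Take \<open>c\<close> coprime monomials, namely those in \<open>A\<close> if \<open>|A| = |B|\<close>, and all elements of \<open>B\<close> but a suitable
  one if \<open>|A| < |B|\<close>, and regard their supports as blocks of variables. In one fixed multidegree, the sum of
  the coefficients of a chain over all transversals of the blocks is a functional that vanishes on
  boundaries, since a set with two elements in one block has exactly two transversals as faces, and these
  occur with opposite signs if the variables are ordered block by block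
  (\<open>transversal_sum_boundary\<close>). In both cases there is an explicit cycle on which the
  functional is a unit (\<open>not_koszul_exact_monomial_ideals\<close>).
\<close>

section \<open>Ideals\<close>

lemma module_times: "Modules.module ((*) :: 'a::comm_ring_1 \<Rightarrow> 'a \<Rightarrow> 'a)"
  by standard (simp_all add: algebra_simps)

text \<open>Ideals of a commutative ring in the type-class sense are submodules of the ring over itself; in
  this form the closure rules of the library for submodules apply, and the Koszul complex can be
  treated over any commutative ring.\<close>

abbreviation ideal_set :: "'a::comm_ring_1 set \<Rightarrow> bool" where
  "ideal_set \<equiv> Modules.module.subspace (*)"

lemmas ideal_set_def = Modules.module.subspace_def [OF module_times]
lemmas ideal_set_0 = Modules.module.subspace_0 [OF module_times]
lemmas ideal_set_add = Modules.module.subspace_add [OF module_times]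
lemmas ideal_set_mult = Modules.module.subspace_scale [OF module_times]
lemmas ideal_set_diff = Modules.module.subspace_diff [OF module_times]
lemmas ideal_set_neg = Modules.module.subspace_neg [OF module_times]
lemmas ideal_set_sum = Modules.module.subspace_sum [OF module_times]

section \<open>The Koszul complex\<close>

text \<open>A sum that changes sign under an involution vanishes. Pairing each term with its image only gives
  \<open>2 s = 0\<close>, which is useless in characteristic 2; the predicate \<open>P\<close> selects one element of each
  pair, so that the two halves cancel over every ring.\<close>

lemma sum_sign_reversing:
  fixes t :: "'p \<Rightarrow> 'a::ab_group_add"
  assumes "finite A"
    and mem: "\<And>p. p \<in> A \<Longrightarrow> \<iota> p \<in> A" and inv: "\<And>p. p \<in> A \<Longrightarrow> \<iota> (\<iota> p) = p"
    and neg: "\<And>p. p \<in> A \<Longrightarrow> t (\<iota> p) = - t p" and swap: "\<And>p. p \<in> A \<Longrightarrow> P (\<iota> p) \<longleftrightarrow> \<not> P p"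
  shows "sum t A = 0"
proof -
  have "sum t A = sum t {p \<in> A. P p} + sum t {p \<in> A. \<not> P p}"
    using \<open>finite A\<close> by (subst sum.union_disjoint [symmetric]) (auto intro: sum.cong)
  also have "sum t {p \<in> A. \<not> P p} = (\<Sum>p | p \<in> A \<and> P p. - t p)"
    by (rule sum.reindex_bij_witness [where i = \<iota> and j = \<iota>]) (use mem inv neg swap in auto)
  finally show ?thesis by (simp add: sum_negf)
qed

text \<open>The sign with which \<open>e\<^sub>a\<close> is moved to its place in the exterior product of the \<open>e\<^sub>b\<close>, \<open>b \<in> F\<close>, when
  the indices are ordered by \<open>r\<close>. The order is kept as a parameter because the nonvanishing argument
  needs one that is adapted to the given monomials.\<close>

definition koszul_sign :: "('n \<Rightarrow> nat) \<Rightarrow> 'n \<Rightarrow> 'n set \<Rightarrow> 'a::comm_ring_1" where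
  "koszul_sign r a F = (- 1) ^ card {b \<in> F. r b < r a}"

lemma koszul_sign_square: "koszul_sign r a F * koszul_sign r a F = 1"
  by (simp add: koszul_sign_def flip: power_mult_distrib)

lemma koszul_sign_square_mult:
  "koszul_sign r a F * b * (koszul_sign r a F * c * d) = b * c * d"
proof -
  have "koszul_sign r a F * b * (koszul_sign r a F * c * d) =
    (koszul_sign r a F * koszul_sign r a F) * (b * c * d)" by (simp only: mult_ac)
  then show ?thesis by (simp add: koszul_sign_square)
qed

lemma koszul_sign_insert:
  fixes F :: "'n::finite set"
  assumes "b \<notin> F"
  shows "koszul_sign r a (insert b F) = (if r b < r a then - 1 else 1) * koszul_sign r a F"
proof -
  have "{c \<in> insert b F. r c < r a} =
    (if r b < r a then insert b {c \<in> F. r c < r a} else {c \<in> F. r c < r a})" by auto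
  then show ?thesis using assms by (simp add: koszul_sign_def)
qed

lemma koszul_sign_swap:
  fixes F :: "'n::finite set"
  assumes "inj r" "a \<noteq> b" "a \<notin> F" "b \<notin> F"
  shows "koszul_sign r a (insert b F) * koszul_sign r b (insert a F) =
    - ((koszul_sign r a F :: 'a::comm_ring_1) * koszul_sign r b F)"
proof -
  have "r a \<noteq> r b" using assms by (auto dest: injD)
  then show ?thesis using assms by (auto simp: koszul_sign_insert)
qed

lemma koszul_sign_swap':
  fixes F :: "'n::finite set"
  assumes "inj r" "a \<noteq> b" "a \<notin> F" "b \<notin> F"
  shows "koszul_sign r a F * koszul_sign r b (insert a F) =
    - ((koszul_sign r b F :: 'a::comm_ring_1) * koszul_sign r a (insert b F))"
proof -
  have "r a \<noteq> r b" using assms by (auto dest: injD)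
  then show ?thesis using assms by (auto simp: koszul_sign_insert algebra_simps)
qed

text \<open>A Koszul chain of degree \<open>p\<close> is its family of coefficients at the sets \<open>F\<close> of cardinality \<open>p\<close>, the
  set \<open>F\<close> standing for the exterior product of the \<open>e\<^sub>a\<close>, \<open>a \<in> F\<close>. Chains of all degrees live in one
  function, since the coefficient of the differential at \<open>F\<close> reads only sets with one more element.\<close>

definition koszul_diff ::
  "('n::finite \<Rightarrow> nat) \<Rightarrow> ('n \<Rightarrow> 'a::comm_ring_1) \<Rightarrow> ('n set \<Rightarrow> 'a) \<Rightarrow> 'n set \<Rightarrow> 'a" where
  "koszul_diff r x y F = (\<Sum>a\<in>- F. koszul_sign r a F * x a * y (insert a F))"

text \<open>Exterior multiplication with \<open>\<Sum> g\<^sub>a e\<^sub>a\<close>.\<close>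

definition koszul_homotopy ::
  "('n::finite \<Rightarrow> nat) \<Rightarrow> ('n \<Rightarrow> 'a::comm_ring_1) \<Rightarrow> ('n set \<Rightarrow> 'a) \<Rightarrow> 'n set \<Rightarrow> 'a" where
  "koszul_homotopy r g y F = (\<Sum>a\<in>F. koszul_sign r a (F - {a}) * g a * y (F - {a}))"

lemma koszul_diff_in:
  assumes "ideal_set N" "\<And>a. a \<notin> F \<Longrightarrow> y (insert a F) \<in> N"
  shows "koszul_diff r x y F \<in> N"
  unfolding koszul_diff_def using assms
  by (intro ideal_set_sum ideal_set_mult) auto

lemma koszul_homotopy_in:
  assumes "ideal_set N" "\<And>a. a \<in> F \<Longrightarrow> y (F - {a}) \<in> N"
  shows "koszul_homotopy r g y F \<in> N"
  unfolding koszul_homotopy_def using assms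
  by (intro ideal_set_sum ideal_set_mult) auto

lemma koszul_diff_minus:
  "koszul_diff r x (\<lambda>F. y F - z F) F = koszul_diff r x y F - koszul_diff r x z F"
  by (simp add: koszul_diff_def algebra_simps sum_subtractf)

lemma koszul_diff_scale: "koszul_diff r x (\<lambda>F. f * y F) F = f * koszul_diff r x y F"
  by (simp add: koszul_diff_def algebra_simps sum_distrib_left)

text \<open>The terms of \<open>d (d y)\<close> at \<open>F\<close> are indexed by ordered pairs of distinct elements outside \<open>F\<close>, and
  exchanging the two elements changes the sign.\<close>

lemma koszul_diff_diff:
  fixes r :: "'n::finite \<Rightarrow> nat" and x :: "'n \<Rightarrow> 'a::comm_ring_1"
  assumes "inj r"
  shows "koszul_diff r x (koszul_diff r x y) F = 0"
proof -
  define t where "t = (\<lambda>(a, b). koszul_sign r a F * koszul_sign r b (insert a F) * (x a * x b) *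
    y (insert b (insert a F)))"
  have "koszul_diff r x (koszul_diff r x y) F = (\<Sum>a\<in>- F. \<Sum>b\<in>- insert a F. t (a, b))"
    unfolding koszul_diff_def t_def by (simp add: sum_distrib_left mult_ac)
  also have "\<dots> = sum t (SIGMA a:- F. - insert a F)"
    by (simp add: sum.Sigma)
  also have "\<dots> = 0"
  proof (rule sum_sign_reversing [where \<iota> = prod.swap and P = "\<lambda>(a, b). r a < r b"])
    fix p assume "p \<in> (SIGMA a:- F. - insert a F)"
    then obtain a b where p: "p = (a, b)" "a \<notin> F" "b \<notin> F" "a \<noteq> b" by auto
    then have sign: "koszul_sign r a F * koszul_sign r b (insert a F) =
        - ((koszul_sign r b F :: 'a) * koszul_sign r a (insert b F))"
      by (intro koszul_sign_swap' assms)
    have "t p = koszul_sign r a F * koszul_sign r b (insert a F) *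
        (x a * x b * y (insert b (insert a F)))"
      by (simp add: p t_def mult_ac)
    also have "\<dots> = - t (prod.swap p)"
      unfolding sign by (simp add: p t_def insert_commute mult_ac)
    finally show "t (prod.swap p) = - t p" by simp
    show "(case prod.swap p of (a, b) \<Rightarrow> r a < r b) = (\<not> (case p of (a, b) \<Rightarrow> r a < r b))"
      using p inj_eq [OF assms, of a b] by auto
  qed auto
  finally show ?thesis .
qed

text \<open>Multiplication with \<open>f = \<Sum> g\<^sub>a x\<^sub>a\<close> is homotopic to zero on the Koszul complex. The diagonal terms
  of the two compositions add up to \<open>f y\<close>, since each index lies either in \<open>F\<close> or in its complement;
  the remaining terms cancel by \<open>koszul_sign_swap\<close>.\<close>

lemma koszul_homotopy_formula:
  fixes r :: "'n::finite \<Rightarrow> nat" and x :: "'n \<Rightarrow> 'a::comm_ring_1"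
  assumes "inj r"
  shows "koszul_diff r x (koszul_homotopy r g y) F + koszul_homotopy r g (koszul_diff r x y) F =
    (\<Sum>a\<in>UNIV. g a * x a) * y F"
proof -
  define s where "s = (\<lambda>a b. koszul_sign r a F * koszul_sign r b (insert a (F - {b})) *
    (x a * g b) * y (insert a (F - {b})))"
  have 1: "koszul_diff r x (koszul_homotopy r g y) F =
      (\<Sum>a\<in>- F. g a * x a * y F + (\<Sum>b\<in>F. s a b))"
    unfolding koszul_diff_def
  proof (rule sum.cong)
    fix a assume a: "a \<in> - F"
    have "koszul_homotopy r g y (insert a F) = koszul_sign r a F * g a * y F +
       (\<Sum>b\<in>F. koszul_sign r b (insert a F - {b}) * g b * y (insert a F - {b}))"
      using a by (simp add: koszul_homotopy_def)
    also have "(\<Sum>b\<in>F. koszul_sign r b (insert a F - {b}) * g b * y (insert a F - {b})) =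
       (\<Sum>b\<in>F. koszul_sign r b (insert a (F - {b})) * g b * y (insert a (F - {b})))"
      using a by (intro sum.cong) (auto simp: insert_Diff_if)
    finally show "koszul_sign r a F * x a * koszul_homotopy r g y (insert a F) =
       g a * x a * y F + (\<Sum>b\<in>F. s a b)"
      using koszul_sign_square_mult [of r a F "x a" "g a" "y F"]
      by (simp add: s_def distrib_left sum_distrib_left mult_ac)
  qed simp
  have 2: "koszul_homotopy r g (koszul_diff r x y) F =
      (\<Sum>b\<in>F. g b * x b * y F + (\<Sum>a\<in>- F. - s a b))"
    unfolding koszul_homotopy_def
  proof (rule sum.cong)
    fix b assume b: "b \<in> F"
    have eq: "- (F - {b}) = insert b (- F)" using b by auto
    have "koszul_diff r x y (F - {b}) = koszul_sign r b (F - {b}) * x b * y F +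
       (\<Sum>a\<in>- F. koszul_sign r a (F - {b}) * x a * y (insert a (F - {b})))"
      using b by (simp add: koszul_diff_def eq insert_absorb)
    moreover have "koszul_sign r b (F - {b}) * g b *
        (\<Sum>a\<in>- F. koszul_sign r a (F - {b}) * x a * y (insert a (F - {b}))) = (\<Sum>a\<in>- F. - s a b)"
      unfolding sum_distrib_left
    proof (rule sum.cong)
      fix a assume a: "a \<in> - F"
      have "koszul_sign r a (insert b (F - {b})) * koszul_sign r b (insert a (F - {b})) =
        - ((koszul_sign r a (F - {b}) :: 'a) * koszul_sign r b (F - {b}))"
        using a b by (intro koszul_sign_swap assms) auto
      then have "koszul_sign r a F * koszul_sign r b (insert a (F - {b})) =
        - ((koszul_sign r a (F - {b}) :: 'a) * koszul_sign r b (F - {b}))"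
        using b by (simp add: insert_absorb)
      then have sign: "koszul_sign r a (F - {b}) * koszul_sign r b (F - {b}) =
        - ((koszul_sign r a F :: 'a) * koszul_sign r b (insert a (F - {b})))"
        by simp
      have "koszul_sign r b (F - {b}) * g b *
         (koszul_sign r a (F - {b}) * x a * y (insert a (F - {b}))) =
         (koszul_sign r a (F - {b}) * koszul_sign r b (F - {b})) *
         (x a * g b) * y (insert a (F - {b}))"
        by (simp only: mult_ac)
      then show "koszul_sign r b (F - {b}) * g b *
         (koszul_sign r a (F - {b}) * x a * y (insert a (F - {b}))) = - s a b"
        unfolding sign by (simp add: s_def)
    qed simp
    ultimately show "koszul_sign r b (F - {b}) * g b * koszul_diff r x y (F - {b}) =
       g b * x b * y F + (\<Sum>a\<in>- F. - s a b)"
      using koszul_sign_square_mult [of r b "F - {b}" "g b" "x b" "y F"]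
      by (simp add: distrib_left)
  qed simp
  have "(\<Sum>b\<in>F. \<Sum>a\<in>- F. s a b) = (\<Sum>a\<in>- F. \<Sum>b\<in>F. s a b)" by (rule sum.swap)
  moreover have "(\<Sum>a\<in>UNIV. g a * x a) = (\<Sum>a\<in>- F. g a * x a) + (\<Sum>a\<in>F. g a * x a)"
    by (subst sum.union_disjoint [symmetric]) (auto intro: sum.cong)
  ultimately show ?thesis
    unfolding 1 2 by (simp add: sum.distrib sum_negf sum_subtractf sum_distrib_right distrib_right)
qed

text \<open>The vanishing of the Koszul homology \<open>H\<^sub>p(x; J/N)\<close>, with classes in \<open>J/N\<close> represented by elements of
  \<open>J\<close>: a chain in \<open>J\<close> is a cycle if its differential has coefficients in \<open>N\<close>, and two chains are
  identified if they differ by coefficients in \<open>N\<close>.\<close>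

definition koszul_exact ::
  "('n::finite \<Rightarrow> nat) \<Rightarrow> ('n \<Rightarrow> 'a::comm_ring_1) \<Rightarrow> 'a set \<Rightarrow> 'a set \<Rightarrow> nat \<Rightarrow> bool" where
  "koszul_exact r x J N p \<longleftrightarrow>
     (\<forall>z. (\<forall>F. z F \<in> J) \<longrightarrow> (\<forall>F. Suc (card F) = p \<longrightarrow> koszul_diff r x z F \<in> N) \<longrightarrow>
        (\<exists>y. (\<forall>F. y F \<in> J) \<and> (\<forall>F. card F = p \<longrightarrow> z F - koszul_diff r x y F \<in> N)))"

text \<open>This is the step \<open>H\<^bsub>p+1\<^esub>(x; M/fM) = 0 \<Longrightarrow> H\<^sub>p(x; M) = 0\<close> for a nonzerodivisor \<open>f \<in> (x)\<close> on
  \<open>M = J/N\<close>, without long exact sequences. For a cycle \<open>z\<close> the chain \<open>h z\<close> is a cycle modulo \<open>f\<close>, because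
  \<open>d (h z) = f z\<close>. By hypothesis \<open>h z = d w + f y\<close>; applying \<open>d\<close> gives \<open>f z = f (d y)\<close>, and \<open>f\<close> cancels.\<close>

lemma koszul_exact_descend:
  fixes r :: "'n::finite \<Rightarrow> nat" and g :: "'n \<Rightarrow> 'a::comm_ring_1"
  assumes "inj r" "ideal_set J" "ideal_set N"
    and f: "f = (\<Sum>a\<in>UNIV. g a * x a)"
    and nonzero_divisor: "\<And>v. v \<in> J \<Longrightarrow> f * v \<in> N \<Longrightarrow> v \<in> N"
    and exact: "koszul_exact r x J {u + f * v | u v. u \<in> N \<and> v \<in> J} (Suc p)"
  shows "koszul_exact r x J N p"
  unfolding koszul_exact_def
proof (intro allI impI)
  fix z assume z: "\<forall>F. z F \<in> J" and cyc: "\<forall>F. Suc (card F) = p \<longrightarrow> koszul_diff r x z F \<in> N"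
  let ?d = "koszul_diff r x" and ?h = "koszul_homotopy r g"
  have dh: "?d (?h z) F = f * z F - ?h (?d z) F" for F
    using koszul_homotopy_formula [OF \<open>inj r\<close>, of x g z F] by (simp add: f algebra_simps)
  have hN: "?h (?d z) F \<in> N" if "card F = p" for F
  proof (rule koszul_homotopy_in [OF \<open>ideal_set N\<close>])
    fix a assume "a \<in> F"
    then have "Suc (card (F - {a})) = p" using that card_Suc_Diff1 [of F a] by simp
    then show "?d z (F - {a}) \<in> N" using cyc by blast
  qed
  have "\<forall>F. ?h z F \<in> J"
    using z by (simp add: koszul_homotopy_in [OF \<open>ideal_set J\<close>])
  moreover have "\<forall>F. Suc (card F) = Suc p \<longrightarrow> ?d (?h z) F \<in> {u + f * v | u v. u \<in> N \<and> v \<in> J}"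
  proof (intro allI impI)
    fix F assume "Suc (card (F :: 'n set)) = Suc p"
    then have "- ?h (?d z) F \<in> N" using hN \<open>ideal_set N\<close> by (simp add: ideal_set_neg)
    moreover have "?d (?h z) F = - ?h (?d z) F + f * z F" by (simp add: dh)
    ultimately show "?d (?h z) F \<in> {u + f * v | u v. u \<in> N \<and> v \<in> J}" using z by blast
  qed
  ultimately obtain w where w: "\<forall>F. w F \<in> J"
    "\<forall>F. card F = Suc p \<longrightarrow> ?h z F - ?d w F \<in> {u + f * v | u v. u \<in> N \<and> v \<in> J}"
    using exact unfolding koszul_exact_def by blast
  \<comment> \<open>For sets of other cardinalities \<open>w\<close> carries no information, and any value in \<open>J\<close> will do.\<close>
  have "\<exists>v. v \<in> J \<and> (card F = Suc p \<longrightarrow> ?h z F - ?d w F - f * v \<in> N)" for F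
  proof (cases "card F = Suc p")
    case True
    then obtain u v where uv: "?h z F - ?d w F = u + f * v" "u \<in> N" "v \<in> J"
      using w(2) by blast
    then have "?h z F - ?d w F - f * v = u" by simp
    with uv show ?thesis by auto
  qed (use ideal_set_0 [OF \<open>ideal_set J\<close>] in auto)
  then obtain y where y: "\<And>F. y F \<in> J"
    "\<And>F. card F = Suc p \<Longrightarrow> ?h z F - ?d w F - f * y F \<in> N" by metis
  show "\<exists>y. (\<forall>F. y F \<in> J) \<and> (\<forall>F. card F = p \<longrightarrow> z F - ?d y F \<in> N)"
  proof (intro exI conjI allI impI)
    fix F assume F: "card (F :: 'n set) = p"
    have "?d (\<lambda>F. ?h z F - ?d w F - f * y F) F \<in> N"
      by (rule koszul_diff_in [OF \<open>ideal_set N\<close>]) (use y F in auto)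
    also have "?d (\<lambda>F. ?h z F - ?d w F - f * y F) F = f * z F - ?h (?d z) F - f * ?d y F"
      by (simp add: koszul_diff_minus koszul_diff_scale koszul_diff_diff \<open>inj r\<close> dh)
    finally have "f * z F - ?h (?d z) F - f * ?d y F + ?h (?d z) F \<in> N"
      using hN [OF F] by (rule ideal_set_add [OF \<open>ideal_set N\<close>])
    then have "f * (z F - ?d y F) \<in> N" by (simp add: algebra_simps)
    moreover have "z F - ?d y F \<in> J"
      using z y by (simp add: ideal_set_diff [OF \<open>ideal_set J\<close>] koszul_diff_in [OF \<open>ideal_set J\<close>])
    ultimately show "z F - ?d y F \<in> N" by (rule nonzero_divisor [rotated])
  qed (rule y)
qed

text \<open>A regular sequence of length \<open>l\<close> in \<open>(x)\<close> kills the Koszul homology in all degrees \<open>p > n - l\<close>: modulo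
  the sequence, \<open>H\<^bsub>p+l\<^esub>\<close> vanishes because no set of variables has \<open>p + l > n\<close> elements, and each element
  of the sequence lowers the degree by one.\<close>

lemma koszul_exact_of_regular:
  fixes r :: "'n::finite \<Rightarrow> nat" and x :: "'n \<Rightarrow> 'a::comm_ring_1"
  assumes "inj r" "ideal_set J"
    and "\<And>k. k \<le> l \<Longrightarrow> ideal_set (N k)"
    and "\<And>k. k < l \<Longrightarrow> N (Suc k) = {u + f k * v | u v. u \<in> N k \<and> v \<in> J}"
    and "\<And>k. k < l \<Longrightarrow> \<exists>g. f k = (\<Sum>a\<in>UNIV. g a * x a)"
    and "\<And>k v. k < l \<Longrightarrow> v \<in> J \<Longrightarrow> f k * v \<in> N k \<Longrightarrow> v \<in> N k"
    and "card (UNIV :: 'n set) < p + l"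
  shows "koszul_exact r x J (N 0) p"
  using assms(3-)
proof (induction l arbitrary: N f p)
  case 0
  have "card F \<noteq> p" for F :: "'n set"
    using 0(5) card_mono [of UNIV F] by auto
  then have "\<forall>F. card F = p \<longrightarrow> z F - koszul_diff r x (\<lambda>F. 0) F \<in> N 0" for z :: "'n set \<Rightarrow> 'a"
    by blast
  moreover have "\<forall>F :: 'n set. (0 :: 'a) \<in> J"
    using ideal_set_0 [OF \<open>ideal_set J\<close>] by blast
  ultimately show ?case
    unfolding koszul_exact_def by meson
next
  case (Suc l)
  have "koszul_exact r x J (N (Suc 0)) (Suc p)"
  proof (rule Suc.IH [of "\<lambda>k. N (Suc k)" "\<lambda>k. f (Suc k)"])
    show "ideal_set (N (Suc k))" if "k \<le> l" for k using that by (intro Suc.prems(1)) simp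
    show "N (Suc (Suc k)) = {u + f (Suc k) * v | u v. u \<in> N (Suc k) \<and> v \<in> J}"
      if "k < l" for k using that by (intro Suc.prems(2)) simp
    show "\<exists>g. f (Suc k) = (\<Sum>a\<in>UNIV. g a * x a)" if "k < l" for k
      using that by (intro Suc.prems(3)) simp
    show "v \<in> N (Suc k)" if "k < l" "v \<in> J" "f (Suc k) * v \<in> N (Suc k)" for k v
      using that(1) by (intro Suc.prems(4) [OF _ that(2,3)]) simp
    show "card (UNIV :: 'n set) < Suc p + l" using Suc.prems(5) by simp
  qed
  moreover have "N (Suc 0) = {u + f 0 * v | u v. u \<in> N 0 \<and> v \<in> J}"
    by (rule Suc.prems(2)) simp
  moreover obtain g where "f 0 = (\<Sum>a\<in>UNIV. g a * x a)"
    using Suc.prems(3) [of 0] by blast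
  ultimately show ?case
    by (intro koszul_exact_descend [OF \<open>inj r\<close> \<open>ideal_set J\<close> Suc.prems(1) _ Suc.prems(4)])
      simp_all
qed

section \<open>Monomials\<close>

text \<open>Divisibility of monomials in terms of exponent vectors. The order that the library puts on
  finitely supported functions is lexicographic, hence the separate symbol.\<close>

definition exp_le :: "('n \<Rightarrow>\<^sub>0 nat) \<Rightarrow> ('n \<Rightarrow>\<^sub>0 nat) \<Rightarrow> bool" (infix "\<preceq>" 50) where
  "a \<preceq> b \<longleftrightarrow> (\<forall>i. Poly_Mapping.lookup a i \<le> Poly_Mapping.lookup b i)"

lemma exp_le_refl [simp]: "a \<preceq> a"
  by (simp add: exp_le_def)

lemma exp_le_trans: "a \<preceq> b \<Longrightarrow> b \<preceq> c \<Longrightarrow> a \<preceq> c"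
  unfolding exp_le_def using le_trans by blast

lemma exp_le_antisym: "a \<preceq> b \<Longrightarrow> b \<preceq> a \<Longrightarrow> a = b"
  by (intro poly_mapping_eqI) (simp add: exp_le_def le_antisym)

lemma exp_le_add [simp]: "a \<preceq> a + b"
  by (simp add: exp_le_def lookup_add)

lemma exp_le_diff_add: "a \<preceq> b \<Longrightarrow> a + (b - a) = b"
  by (intro poly_mapping_eqI) (simp add: exp_le_def lookup_add lookup_minus)

lemma exp_le_keys: "a \<preceq> b \<Longrightarrow> Poly_Mapping.keys a \<subseteq> Poly_Mapping.keys b"
  unfolding exp_le_def subset_iff in_keys_iff by (metis le_0_eq)

lemma lookup_monomial_mult:
  "Poly_Mapping.lookup (monomial a * p) b = (if a \<preceq> b then Poly_Mapping.lookup p (b - a) else 0)"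
proof -
  have "Poly_Mapping.lookup (monomial a * p) b =
      (\<Sum>l. (\<Sum>q. Poly_Mapping.lookup p q when b = l + q) when a = l)"
    by (simp add: lookup_mult monomial_def lookup_single when_mult)
  also have "\<dots> = (\<Sum>q. Poly_Mapping.lookup p q when b = a + q)"
    by simp
  also have "\<dots> = (if a \<preceq> b then Poly_Mapping.lookup p (b - a) else 0)"
  proof (cases "a \<preceq> b")
    case True
    then have "b = a + q \<longleftrightarrow> q = b - a" for q
      using exp_le_diff_add [OF True] by auto
    then show ?thesis using True by simp
  next
    case False
    then have "b \<noteq> a + q" for q by auto
    then show ?thesis using False by simp
  qed
  finally show ?thesis .
qed

lemma monomial_mult: "monomial a * monomial b = monomial (a + b)"
  by (simp add: monomial_def mult_single)

lemma keys_monomial [simp]: "Poly_Mapping.keys (monomial a) = {a}"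
  by (simp add: monomial_def)

lemma lookup_monomial: "Poly_Mapping.lookup (monomial a) b = (if a = b then 1 else 0)"
  by (simp add: monomial_def lookup_single when_def)

lemma lookup_koszul_sign_mult:
  "Poly_Mapping.lookup (koszul_sign r a F * p) b = koszul_sign r a F * Poly_Mapping.lookup p b"
  by (cases "even (card {b \<in> F. r b < r a})") (simp_all add: koszul_sign_def)

definition exp_of_set :: "'n::finite set \<Rightarrow> 'n \<Rightarrow>\<^sub>0 nat" where
  "exp_of_set T = (\<Sum>i\<in>T. Poly_Mapping.single i 1)"

lemma lookup_exp_of_set: "Poly_Mapping.lookup (exp_of_set T) i = (if i \<in> T then 1 else 0)"
  by (simp add: exp_of_set_def lookup_sum lookup_single when_def)

text \<open>In multidegree \<open>\<delta>\<close>, the coefficient of a chain at \<open>T\<close> is a multiple of the monomial with exponent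
  \<open>\<delta> - T\<close>. The case in which \<open>\<delta>\<close> does not involve \<open>x\<^sub>a\<close> is separate, because there truncated
  subtraction identifies \<open>\<delta> - T - {a}\<close> with \<open>\<delta> - T\<close>.\<close>

lemma lookup_var_mult:
  assumes "a \<notin> T"
  shows "Poly_Mapping.lookup (var a * p) (\<delta> - exp_of_set T) =
    (if Poly_Mapping.lookup \<delta> a = 0 then 0 else Poly_Mapping.lookup p (\<delta> - exp_of_set (insert a T)))"
proof -
  have "\<delta> - exp_of_set T - Poly_Mapping.single a 1 = \<delta> - exp_of_set (insert a T)"
    using assms
    by (intro poly_mapping_eqI) (auto simp: lookup_minus lookup_exp_of_set lookup_single when_def)
  moreover have "Poly_Mapping.single a 1 \<preceq> \<delta> - exp_of_set T \<longleftrightarrow> Poly_Mapping.lookup \<delta> a \<noteq> 0"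
    using assms
    by (auto simp: exp_le_def lookup_minus lookup_exp_of_set lookup_single when_def
        split: if_splits)
  ultimately show ?thesis
    by (simp add: var_def lookup_monomial_mult)
qed

section \<open>Nonvanishing of Koszul homology\<close>

text \<open>The colour classes of \<open>col\<close> divide \<open>X\<close> into blocks; a transversal picks one element of each block.\<close>

definition transversals :: "('n \<Rightarrow> nat) \<Rightarrow> 'n set \<Rightarrow> 'n set set" where
  "transversals col X = {T. T \<subseteq> X \<and> bij_betw col T (col ` X)}"

text \<open>The linear functional that detects a nonzero homology class of multidegree \<open>\<delta>\<close>: the sum of the
  coefficients of the monomials \<open>x\<^sup>\<delta> / x\<^sub>T\<close> at all transversals \<open>T\<close>.\<close>

definition transversal_sum ::
  "('n \<Rightarrow> nat) \<Rightarrow> 'n set \<Rightarrow> ('n \<Rightarrow>\<^sub>0 nat) \<Rightarrow> ('n::finite set \<Rightarrow> ('n, 'k::field) mpol) \<Rightarrow> 'k" where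
  "transversal_sum col X \<delta> y =
     (\<Sum>T\<in>transversals col X. Poly_Mapping.lookup (y T) (\<delta> - exp_of_set T))"

lemma card_transversal: "T \<in> transversals col X \<Longrightarrow> card T = card (col ` X)"
  by (auto simp: transversals_def intro: bij_betw_same_card)

text \<open>Replacing the element \<open>b\<close> of \<open>T\<close> in the block of \<open>a\<close> by \<open>a\<close> yields another transversal, and doing the
  same with \<open>b\<close> undoes it. This is the involution behind \<open>transversal_sum_boundary\<close>.\<close>

lemma transversal_exchange:
  fixes col :: "'n::finite \<Rightarrow> nat"
  assumes T: "T \<in> transversals col X" and a: "a \<in> X - T"
  defines "b \<equiv> the_inv_into T col (col a)"
  shows "b \<in> T" "col b = col a" "insert a (T - {b}) \<in> transversals col X"
    "b \<in> X - insert a (T - {b})" "the_inv_into (insert a (T - {b})) col (col b) = a"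
    "insert b (insert a (T - {b}) - {a}) = T"
proof -
  have inj: "inj_on col T" and im: "col ` T = col ` X" and TX: "T \<subseteq> X"
    using T by (auto simp: transversals_def bij_betw_def)
  have ca: "col a \<in> col ` T" using im a by auto
  show bT: "b \<in> T" unfolding b_def by (rule the_inv_into_into [OF inj ca subset_refl])
  show cb: "col b = col a" unfolding b_def by (rule f_the_inv_into_f [OF inj ca])
  have new: "col a \<notin> col ` (T - {b})"
    using inj bT cb by (auto simp: inj_on_def)
  have inj': "inj_on col (insert a (T - {b}))"
    using inj new by (auto intro: inj_on_subset)
  have "col ` insert a (T - {b}) = insert (col b) (col ` (T - {b}))" by (simp add: cb)
  also have "\<dots> = col ` T" using bT by auto
  finally show "insert a (T - {b}) \<in> transversals col X"
    using inj' im TX a by (auto simp: transversals_def bij_betw_def)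
  show "b \<in> X - insert a (T - {b})" using bT TX a by auto
  show "the_inv_into (insert a (T - {b})) col (col b) = a"
    unfolding cb by (rule the_inv_into_f_f [OF inj']) simp
  show "insert b (insert a (T - {b}) - {a}) = T" using bT a by auto
qed

text \<open>The functional vanishes on boundaries. A set \<open>T \<union> {a}\<close> with \<open>a \<in> X\<close> contains exactly two transversals,
  obtained by dropping either of its two elements in the block of \<open>a\<close>. As blocks are contiguous in the
  order \<open>r\<close>, these two elements are neighbours in \<open>T \<union> {a}\<close>, and so occur in the differential with
  opposite signs. Sets \<open>T \<union> {a}\<close> with \<open>a \<notin> X\<close> contain only one transversal; for them the coefficient has
  to vanish by assumption.\<close>

lemma transversal_sum_boundary:
  fixes w :: "'n::finite set \<Rightarrow> ('n, 'k::field) mpol"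
  assumes "inj r" and mono: "\<And>a b. col a < col b \<Longrightarrow> r a < r b"
    and pos: "\<And>a. a \<in> X \<Longrightarrow> Poly_Mapping.lookup \<delta> a \<noteq> 0"
    and outside: "\<And>T a. T \<in> transversals col X \<Longrightarrow> a \<notin> X \<Longrightarrow> Poly_Mapping.lookup \<delta> a \<noteq> 0 \<Longrightarrow>
      Poly_Mapping.lookup (w (insert a T)) (\<delta> - exp_of_set (insert a T)) = 0"
  shows "transversal_sum col X \<delta> (koszul_diff r var w) = 0"
proof -
  let ?c = "\<lambda>F. Poly_Mapping.lookup (w F) (\<delta> - exp_of_set F)"
  let ?A = "SIGMA T:transversals col X. X - T"
  define t where "t = (\<lambda>(T, a). koszul_sign r a T * ?c (insert a T))"
  define partner where "partner = (\<lambda>(T, a). the_inv_into T col (col a))"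
  define \<iota> where "\<iota> = (\<lambda>p. (insert (snd p) (fst p - {partner p}), partner p))"
  have "Poly_Mapping.lookup (koszul_diff r var w T) (\<delta> - exp_of_set T) = (\<Sum>a\<in>X - T. t (T, a))"
    if T: "T \<in> transversals col X" for T
  proof -
    have "Poly_Mapping.lookup (koszul_diff r var w T) (\<delta> - exp_of_set T) =
      (\<Sum>a\<in>- T. koszul_sign r a T * (if Poly_Mapping.lookup \<delta> a = 0 then 0 else ?c (insert a T)))"
      unfolding koszul_diff_def lookup_sum
      by (intro sum.cong) (simp_all add: mult.assoc lookup_koszul_sign_mult lookup_var_mult)
    also have "\<dots> = (\<Sum>a\<in>X - T. t (T, a))"
    proof (rule sum.mono_neutral_cong_right)
      show "\<forall>a\<in>- T - (X - T). koszul_sign r a T *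
          (if Poly_Mapping.lookup \<delta> a = 0 then 0 else ?c (insert a T)) = 0"
        using outside [OF T] by auto
    qed (auto simp: t_def dest: pos)
    finally show ?thesis .
  qed
  then have "transversal_sum col X \<delta> (koszul_diff r var w) = sum t ?A"
    by (simp add: transversal_sum_def sum.Sigma)
  also have "\<dots> = 0"
  proof (rule sum_sign_reversing [where \<iota> = \<iota> and P = "\<lambda>p. r (snd p) < r (partner p)"])
    fix p assume "p \<in> ?A"
    then obtain T a where p: "p = (T, a)" and T: "T \<in> transversals col X" and a: "a \<in> X - T"
      by auto
    define b G where "b = partner p" and "G = T - {b}"
    have b: "b = the_inv_into T col (col a)" by (simp add: b_def partner_def p)
    note ex = transversal_exchange [OF T a, folded b]
    have \<iota>: "\<iota> p = (insert a G, b)" by (simp add: \<iota>_def p b_def G_def)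
    have partner: "partner (insert a G, b) = a"
      using ex(5) by (simp add: partner_def G_def)
    show "\<iota> p \<in> ?A" using ex(3,4) by (simp add: \<iota> G_def)
    have "\<iota> (insert a G, b) = (T, a)"
      unfolding \<iota>_def fst_conv snd_conv partner using ex(6) by (simp add: G_def)
    then show "\<iota> (\<iota> p) = p" by (subst \<iota>) (simp add: p)
    have "a \<noteq> b" using ex(1) a by auto
    then have ne: "r a \<noteq> r b" using \<open>inj r\<close> by (auto dest: injD)
    show "r (snd (\<iota> p)) < r (partner (\<iota> p)) \<longleftrightarrow> \<not> r (snd p) < r (partner p)"
      unfolding \<iota> partner using ne by (auto simp: p b_def)
    \<comment> \<open>The elements of \<open>G\<close> lie in other blocks, so they compare in the same way with \<open>a\<close> and \<open>b\<close>.\<close>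
    have "r d < r a \<longleftrightarrow> r d < r b" if "d \<in> G" for d
    proof -
      have "col d \<noteq> col b"
        using that ex(1) T by (auto simp: G_def transversals_def bij_betw_def inj_on_def)
      then show ?thesis
        using mono [of d a] mono [of a d] mono [of d b] mono [of b d] ex(2)
        by (metis less_asym linorder_neqE_nat)
    qed
    then have eq: "{d \<in> G. r d < r a} = {d \<in> G. r d < r b}" by auto
    have sG: "koszul_sign r a G = (koszul_sign r b G :: 'k)"
      by (simp add: koszul_sign_def eq)
    have "T = insert b G" "a \<notin> G" "b \<notin> G" using ex(1) a by (auto simp: G_def)
    then have "t (insert a G, b) = - t (T, a)"
      using ne by (auto simp: t_def koszul_sign_insert sG insert_commute)
    then show "t (\<iota> p) = - t p" by (subst \<iota>) (simp add: p)
  qed simp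
  finally show ?thesis .
qed

text \<open>A cycle on which the functional does not vanish is not a boundary, provided the functional is well
  defined on chains modulo \<open>N\<close>.\<close>

lemma not_koszul_exact:
  fixes J N :: "('n::finite, 'k::field) mpol set"
  assumes "inj r" and "\<And>a b. col a < col b \<Longrightarrow> r a < r b"
    and pos: "\<And>a. a \<in> X \<Longrightarrow> Poly_Mapping.lookup \<delta> a \<noteq> 0"
    and J: "\<And>u T a. u \<in> J \<Longrightarrow> T \<in> transversals col X \<Longrightarrow> a \<notin> X \<Longrightarrow> Poly_Mapping.lookup \<delta> a \<noteq> 0 \<Longrightarrow>
      Poly_Mapping.lookup u (\<delta> - exp_of_set (insert a T)) = 0"
    and N: "\<And>u T. u \<in> N \<Longrightarrow> T \<in> transversals col X \<Longrightarrow> Poly_Mapping.lookup u (\<delta> - exp_of_set T) = 0"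
    and z: "\<And>F. z F \<in> J" "\<And>F. Suc (card F) = card (col ` X) \<Longrightarrow> koszul_diff r var z F \<in> N"
      "transversal_sum col X \<delta> z \<noteq> 0"
  shows "\<not> koszul_exact r var J N (card (col ` X))"
proof
  assume "koszul_exact r var J N (card (col ` X))"
  then obtain y where y: "\<And>F. y F \<in> J"
    "\<And>F. card F = card (col ` X) \<Longrightarrow> z F - koszul_diff r var y F \<in> N"
    using z(1,2) unfolding koszul_exact_def by blast
  have "transversal_sum col X \<delta> z - transversal_sum col X \<delta> (koszul_diff r var y) =
    (\<Sum>T\<in>transversals col X. Poly_Mapping.lookup (z T - koszul_diff r var y T) (\<delta> - exp_of_set T))"
    by (simp add: transversal_sum_def lookup_minus sum_subtractf)
  also have "\<dots> = 0"
    using N y(2) by (intro sum.neutral) (auto dest: card_transversal)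
  finally show False
    using transversal_sum_boundary [of r col X \<delta> y] assms(1,2) pos J y(1) z(3) by simp
qed

lemma koszul_diff_single_in:
  assumes "ideal_set N" "\<And>a. a \<in> T \<Longrightarrow> x a * p \<in> N"
  shows "koszul_diff r x (\<lambda>F. if F = T then p else 0) F \<in> N"
  unfolding koszul_diff_def
proof (intro ideal_set_sum [OF assms(1)])
  fix a assume "a \<in> - F"
  have "x a * (if insert a F = T then p else 0) \<in> N"
    using assms(2) [of a] ideal_set_0 [OF assms(1)] by auto
  then show "koszul_sign r a F * x a * (if insert a F = T then p else 0) \<in> N"
    unfolding mult.assoc by (rule ideal_set_mult [OF assms(1)])
qed

lemma koszul_diff_single:
  assumes "a \<notin> F"
  shows "koszul_diff r x (\<lambda>G. if G = insert a F then p else 0) F = koszul_sign r a F * x a * p"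
proof -
  have "insert b F = insert a F \<longleftrightarrow> b = a" if "b \<in> - F" for b using that assms by auto
  then have "koszul_diff r x (\<lambda>G. if G = insert a F then p else 0) F =
    (\<Sum>b\<in>- F. if b = a then koszul_sign r a F * x a * p else 0)"
    unfolding koszul_diff_def by (intro sum.cong) auto
  then show ?thesis using assms by simp
qed

text \<open>The class used if \<open>J\<close> and \<open>N\<close> have equally many generators: a chain with the single coefficient
  \<open>x\<^sup>\<delta> / x\<^sub>T\<close>.\<close>

lemma not_koszul_exact_direct:
  fixes J N :: "('n::finite, 'k::field) mpol set"
  assumes "inj r" and "\<And>a b. col a < col b \<Longrightarrow> r a < r b"
    and "\<And>a. a \<in> X \<Longrightarrow> Poly_Mapping.lookup \<delta> a \<noteq> 0"
    and "\<And>a. a \<notin> X \<Longrightarrow> Poly_Mapping.lookup \<delta> a = 0"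
    and "ideal_set J" "ideal_set N"
    and "\<And>u T. u \<in> N \<Longrightarrow> T \<in> transversals col X \<Longrightarrow> Poly_Mapping.lookup u (\<delta> - exp_of_set T) = 0"
    and T: "T \<in> transversals col X" and "monomial (\<delta> - exp_of_set T) \<in> J"
    and "\<And>a. a \<in> T \<Longrightarrow> var a * monomial (\<delta> - exp_of_set T) \<in> N"
  shows "\<not> koszul_exact r var J N (card (col ` X))"
proof (rule not_koszul_exact [where \<delta> = \<delta>])
  let ?z = "\<lambda>F. if F = T then monomial (\<delta> - exp_of_set T) else 0"
  have "transversal_sum col X \<delta> ?z = (\<Sum>F\<in>transversals col X. if F = T then 1 else 0)"
    unfolding transversal_sum_def by (intro sum.cong) (auto simp: lookup_monomial)
  also have "\<dots> = 1" using T by simp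
  finally show "transversal_sum col X \<delta> ?z \<noteq> 0" by (metis zero_neq_one)
  show "koszul_diff r var ?z F \<in> N" for F
    using assms by (intro koszul_diff_single_in) auto
  show "?z F \<in> J" for F using assms ideal_set_0 [of J] by auto
qed (use assms in auto)

text \<open>The class used if \<open>J\<close> has more generators than \<open>N\<close>: the differential of the chain with the single
  coefficient \<open>x\<^sup>\<delta> / x\<^sub>F\<close> at \<open>F = T \<union> {e}\<close>. That chain itself does not have coefficients in \<open>J\<close>, only its
  differential does, so the class is an image under the connecting map
  \<open>H\<^bsub>c+1\<^esub>(x; S/J) \<rightarrow> H\<^sub>c(x; J/N)\<close>. Among the sets \<open>F - {a}\<close> only \<open>T = F - {e}\<close> is a transversal.\<close>

lemma not_koszul_exact_connecting:
  fixes J N :: "('n::finite, 'k::field) mpol set"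
  assumes "inj r" and "\<And>a b. col a < col b \<Longrightarrow> r a < r b"
    and "\<And>a. a \<in> X \<Longrightarrow> Poly_Mapping.lookup \<delta> a \<noteq> 0"
    and "\<And>u T a. u \<in> J \<Longrightarrow> T \<in> transversals col X \<Longrightarrow> a \<notin> X \<Longrightarrow> Poly_Mapping.lookup \<delta> a \<noteq> 0 \<Longrightarrow>
      Poly_Mapping.lookup u (\<delta> - exp_of_set (insert a T)) = 0"
    and "ideal_set J" "ideal_set N"
    and "\<And>u T. u \<in> N \<Longrightarrow> T \<in> transversals col X \<Longrightarrow> Poly_Mapping.lookup u (\<delta> - exp_of_set T) = 0"
    and T: "T \<in> transversals col X" and e: "e \<notin> X" "Poly_Mapping.lookup \<delta> e \<noteq> 0"
    and J: "\<And>a. a \<in> insert e T \<Longrightarrow> var a * monomial (\<delta> - exp_of_set (insert e T)) \<in> J"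
  shows "\<not> koszul_exact r var J N (card (col ` X))"
proof (rule not_koszul_exact [where \<delta> = \<delta>])
  let ?m = "monomial (\<delta> - exp_of_set (insert e T)) :: ('n, 'k) mpol"
  let ?z = "koszul_diff r var (\<lambda>F. if F = insert e T then ?m else 0)"
  show "?z F \<in> J" for F
    using J \<open>ideal_set J\<close> by (intro koszul_diff_single_in)
  show "koszul_diff r var ?z F \<in> N" for F
    using ideal_set_0 [OF \<open>ideal_set N\<close>] by (simp add: koszul_diff_diff \<open>inj r\<close>)
  have eT: "e \<notin> F" if "F \<in> transversals col X" for F
    using that e by (auto simp: transversals_def)
  have "Poly_Mapping.lookup (?z F) (\<delta> - exp_of_set F) = (if F = T then koszul_sign r e T else 0)"
    if F: "F \<in> transversals col X" for F
  proof (cases "F = T")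
    case True
    then show ?thesis
      using eT [OF T] e
      by (simp add: koszul_diff_single mult.assoc lookup_koszul_sign_mult lookup_var_mult
          lookup_monomial)
  next
    case False
    have "insert a F \<noteq> insert e T" if "a \<notin> F" for a
      using False eT [OF F] eT [OF T] by (metis insertE insertI1 insert_ident)
    then have "?z F = 0" unfolding koszul_diff_def by (intro sum.neutral) auto
    then show ?thesis using False by simp
  qed
  then have "transversal_sum col X \<delta> ?z =
      (\<Sum>F\<in>transversals col X. if F = T then koszul_sign r e T else 0)"
    unfolding transversal_sum_def by (intro sum.cong) auto
  then show "transversal_sum col X \<delta> ?z \<noteq> 0"
    using T by (simp add: koszul_sign_def)
qed (use assms in auto)

text \<open>Sorting the variables first by colour and then arbitrarily makes the blocks contiguous.\<close>

lemma block_order: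
  fixes col :: "'n::finite \<Rightarrow> nat"
  obtains r :: "'n \<Rightarrow> nat" where "inj r" "\<And>a b. col a < col b \<Longrightarrow> r a < r b"
proof -
  define n where "n = card (UNIV :: 'n set)"
  obtain h :: "'n \<Rightarrow> nat" where h: "bij_betw h UNIV {0..<n}"
    unfolding n_def using ex_bij_betw_finite_nat [of "UNIV :: 'n set"] by auto
  then have less: "h a < n" for a by (auto simp: bij_betw_def)
  define r where "r a = col a * n + h a" for a
  have mono: "r a < r b" if "col a < col b" for a b
  proof -
    have "r a < Suc (col a) * n" using less [of a] by (simp add: r_def)
    also have "\<dots> \<le> col b * n" using that by (intro mult_right_mono) auto
    finally show ?thesis by (simp add: r_def)
  qed
  have "inj r"
  proof (rule injI)
    fix a b assume eq: "r a = r b"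
    then have "col a = col b" using mono [of a b] mono [of b a] by (cases "col a" "col b" rule: linorder_cases) auto
    then have "h a = h b" using eq by (simp add: r_def)
    then show "a = b" using h by (auto simp: bij_betw_def dest: injD)
  qed
  then show ?thesis using mono that by blast
qed

section \<open>Monomial ideals\<close>

definition monomial_ideal :: "('n \<Rightarrow>\<^sub>0 nat) set \<Rightarrow> ('n, 'k::field) mpol set" where
  "monomial_ideal A = {f. \<forall>b\<in>Poly_Mapping.keys f. \<exists>a\<in>A. a \<preceq> b}"

lemma ideal_set_monomial_ideal: "ideal_set (monomial_ideal A :: ('n, 'k::field) mpol set)"
  unfolding ideal_set_def
proof (intro conjI ballI allI)
  show "(0 :: ('n, 'k) mpol) \<in> monomial_ideal A" by (simp add: monomial_ideal_def)
next
  fix f g :: "('n, 'k) mpol" assume "f \<in> monomial_ideal A" "g \<in> monomial_ideal A"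
  then show "f + g \<in> monomial_ideal A"
    using keys_add [of f g] by (auto simp: monomial_ideal_def)
next
  fix h f :: "('n, 'k) mpol" assume f: "f \<in> monomial_ideal A"
  show "h * f \<in> monomial_ideal A"
    unfolding monomial_ideal_def
  proof safe
    fix b assume "b \<in> Poly_Mapping.keys (h * f)"
    then obtain c d where b: "b = c + d" and "d \<in> Poly_Mapping.keys f"
      using keys_mult [of h f] by auto
    then obtain a where "a \<in> A" "a \<preceq> d" using f by (auto simp: monomial_ideal_def)
    then show "\<exists>a\<in>A. a \<preceq> b"
      unfolding b by (metis add.commute exp_le_add exp_le_trans)
  qed
qed

lemma monomial_in_monomial_ideal: "monomial b \<in> monomial_ideal A \<longleftrightarrow> (\<exists>a\<in>A. a \<preceq> b)"
  by (simp add: monomial_ideal_def)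

lemma monomial_in_monomial_idealI: "a \<in> A \<Longrightarrow> monomial a \<in> monomial_ideal A"
  unfolding monomial_in_monomial_ideal by (rule bexI [of _ a]) simp_all

lemma lookup_monomial_ideal:
  "f \<in> monomial_ideal A \<Longrightarrow> (\<And>a. a \<in> A \<Longrightarrow> \<not> a \<preceq> b) \<Longrightarrow> Poly_Mapping.lookup f b = 0"
  unfolding monomial_ideal_def by (auto simp flip: not_in_keys_iff_lookup_eq_zero)

lemma sum_single_lookup:
  "f = (\<Sum>b\<in>Poly_Mapping.keys f. Poly_Mapping.single b (Poly_Mapping.lookup f b))"
  by (rule poly_mapping_eqI)
    (simp add: lookup_sum lookup_single when_def not_in_keys_iff_lookup_eq_zero)

lemma monomial_ideal_minimal:
  fixes N :: "('n, 'k::field) mpol set"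
  assumes "ideal_set N" "monomial ` A \<subseteq> N"
  shows "monomial_ideal A \<subseteq> N"
proof
  fix f :: "('n, 'k) mpol" assume f: "f \<in> monomial_ideal A"
  have "(\<Sum>b\<in>Poly_Mapping.keys f. Poly_Mapping.single b (Poly_Mapping.lookup f b)) \<in> N"
  proof (rule ideal_set_sum [OF assms(1)])
    fix b assume "b \<in> Poly_Mapping.keys f"
    then obtain a where "a \<in> A" "a \<preceq> b" using f by (auto simp: monomial_ideal_def)
    then have "Poly_Mapping.single b (Poly_Mapping.lookup f b) =
      Poly_Mapping.single (b - a) (Poly_Mapping.lookup f b) * monomial a"
      by (simp add: monomial_def mult_single add.commute [of "b - a"] exp_le_diff_add)
    then show "Poly_Mapping.single b (Poly_Mapping.lookup f b) \<in> N"
      using assms \<open>a \<in> A\<close> by (auto intro: ideal_set_mult)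
  qed
  then show "f \<in> N" using sum_single_lookup [of f] by simp
qed

section \<open>The polynomial ring as a ring and a module\<close>

lemma polyring_simps [simp]:
  "carrier polyring = UNIV" "add polyring = (+)" "monoid.mult polyring = (*)"
  "ring.zero polyring = 0" "one polyring = 1" "smult polyring = (*)"
  by (simp_all add: polyring_def)

lemma cring_polyring: "cring (polyring :: (('n::finite, 'k::field) mpol, _) module)"
proof (rule cringI)
  show "abelian_group (polyring :: (('n, 'k) mpol, _) module)"
    by (rule abelian_groupI) (auto simp: add.assoc add.commute intro: exI [of _ "- _"])
  show "comm_monoid (polyring :: (('n, 'k) mpol, _) module)"
    by (rule comm_monoidI) (auto simp: mult_ac)
qed (simp add: distrib_right)

interpretation polyring: cring "polyring :: (('n::finite, 'k::field) mpol, _) module"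
  by (rule cring_polyring)

lemma polyring_minus: "a_inv polyring f = - (f :: ('n::finite, 'k::field) mpol)"
proof -
  have "f \<oplus>\<^bsub>polyring\<^esub> (- f) = \<zero>\<^bsub>polyring\<^esub>" by simp
  then show ?thesis
    by (intro polyring.minus_equality) (simp_all add: add.commute)
qed

lemma ideal_polyring_iff: "ideal N polyring \<longleftrightarrow> ideal_set (N :: ('n::finite, 'k::field) mpol set)"
proof
  assume "ideal N polyring"
  then interpret ideal N polyring .
  show "ideal_set N"
    unfolding ideal_set_def
    using additive_subgroup.zero_closed [OF is_additive_subgroup] a_closed I_l_closed by auto
next
  assume N: "ideal_set N"
  show "ideal N polyring"
  proof (rule idealI)
    show "ring (polyring :: (('n, 'k) mpol, _) module)" by (rule polyring.ring_axioms)
    show "subgroup N (add_monoid polyring)"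
    proof (rule polyring.add.subgroupI)
      show "N \<noteq> {}" using ideal_set_0 [OF N] by blast
    qed (use N in \<open>auto simp: polyring_minus intro: ideal_set_neg ideal_set_add\<close>)
    show "x \<otimes>\<^bsub>polyring\<^esub> a \<in> N" "a \<otimes>\<^bsub>polyring\<^esub> x \<in> N" if "a \<in> N" for a x
      using ideal_set_mult [OF N that, of x] by (simp_all add: mult.commute)
  qed
qed

lemma Idl_polyring_minimal: "ideal_set N \<Longrightarrow> S \<subseteq> N \<Longrightarrow> Idl\<^bsub>polyring\<^esub> S \<subseteq> N"
  by (intro polyring.genideal_minimal) (simp_all add: ideal_polyring_iff)

lemma Idl_monomial: "Idl\<^bsub>polyring\<^esub> (monomial ` A) = monomial_ideal (A :: ('n::finite \<Rightarrow>\<^sub>0 nat) set)"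
proof
  show "Idl\<^bsub>polyring\<^esub> (monomial ` A) \<subseteq> monomial_ideal A"
    by (rule Idl_polyring_minimal [OF ideal_set_monomial_ideal])
      (auto intro: monomial_in_monomial_idealI)
  show "monomial_ideal A \<subseteq> Idl\<^bsub>polyring\<^esub> (monomial ` A)"
  proof (rule monomial_ideal_minimal)
    show "ideal_set (Idl\<^bsub>polyring\<^esub> (monomial ` A))"
      unfolding ideal_polyring_iff [symmetric] by (rule polyring.genideal_ideal) simp
    show "monomial ` A \<subseteq> Idl\<^bsub>polyring\<^esub> (monomial ` A)"
      by (rule polyring.genideal_self) simp
  qed
qed

lemma max_graded_idealE:
  fixes f :: "('n::finite, 'k::field) mpol"
  assumes "f \<in> max_graded_ideal"
  obtains g where "f = (\<Sum>a\<in>UNIV. g a * var a)"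
proof -
  let ?N = "{f :: ('n, 'k) mpol. \<exists>g. f = (\<Sum>a\<in>UNIV. g a * var a)}"
  have "Idl\<^bsub>polyring\<^esub> (range var) \<subseteq> ?N"
  proof (rule Idl_polyring_minimal)
    show "ideal_set ?N"
      unfolding ideal_set_def
    proof (intro conjI ballI allI)
      show "0 \<in> ?N" by (auto intro!: exI [of _ "\<lambda>a. 0"])
      show "u + v \<in> ?N" if "u \<in> ?N" "v \<in> ?N" for u v
      proof -
        obtain g h where "u = (\<Sum>a\<in>UNIV. g a * var a)" "v = (\<Sum>a\<in>UNIV. h a * var a)"
          using \<open>u \<in> ?N\<close> \<open>v \<in> ?N\<close> by blast
        then have "u + v = (\<Sum>a\<in>UNIV. (g a + h a) * var a)"
          by (simp add: distrib_right sum.distrib)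
        then show ?thesis by auto
      qed
      show "c * u \<in> ?N" if "u \<in> ?N" for c u
      proof -
        obtain g where "u = (\<Sum>a\<in>UNIV. g a * var a)"
          using \<open>u \<in> ?N\<close> by blast
        then have "c * u = (\<Sum>a\<in>UNIV. (c * g a) * var a)"
          by (simp add: sum_distrib_left mult.assoc)
        then show ?thesis by auto
      qed
    qed
    show "range var \<subseteq> ?N"
    proof
      fix u :: "('n, 'k) mpol" assume "u \<in> range var"
      then obtain b where u: "u = var b" by blast
      define g where "g a = (if a = b then 1 else 0 :: ('n, 'k) mpol)" for a
      have "u = (\<Sum>a\<in>UNIV. g a * var a)"
        by (simp add: u g_def if_distrib [of "\<lambda>x. x * _"] cong: if_cong)
      then show "u \<in> ?N" by blast
    qed
  qed
  then show ?thesis using assms that unfolding max_graded_ideal_def by blast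
qed

lemma finsum_polyring: "finite A \<Longrightarrow> (\<Oplus>\<^bsub>polyring\<^esub>i\<in>A. f i) = sum f A"
  by (induction A rule: finite_induct) simp_all

lemma seq_submodule_monomials:
  "seq_submodule polyring (map monomial as) = (monomial_ideal (set as) :: ('n::finite, 'k::field) mpol set)"
proof -
  define c where "c v = (\<Sum>i<length as. monomial (as ! i) * (v i :: ('n, 'k) mpol))" for v
  have "seq_submodule polyring (map monomial as) = range c"
    by (auto simp: seq_submodule_def finsum_polyring c_def image_iff)
  also have "range c = monomial_ideal (set as)"
  proof
    show "range c \<subseteq> monomial_ideal (set as)"
    proof clarify
      fix v :: "nat \<Rightarrow> ('n, 'k) mpol"
      have "v i * monomial (as ! i) \<in> monomial_ideal (set as)" if "i < length as" for i
        using that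
        by (intro ideal_set_mult [OF ideal_set_monomial_ideal] monomial_in_monomial_idealI) simp
      then show "c v \<in> monomial_ideal (set as)"
        unfolding c_def
        by (intro ideal_set_sum [OF ideal_set_monomial_ideal]) (simp add: mult.commute)
    qed
    show "monomial_ideal (set as) \<subseteq> range c"
    proof (rule monomial_ideal_minimal)
      have "c (\<lambda>i. 0) = 0" by (simp add: c_def)
      then have "0 \<in> range c" by (metis rangeI)
      moreover have "c v + c w = c (\<lambda>i. v i + w i)" for v w
        by (simp add: c_def distrib_left sum.distrib)
      moreover have "h * c v = c (\<lambda>i. h * v i)" for h v
        by (simp add: c_def sum_distrib_left mult.left_commute)
      ultimately show "ideal_set (range c)"
        unfolding ideal_set_def by auto
      show "monomial ` set as \<subseteq> range c"
      proof clarify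
        fix a assume "a \<in> set as"
        then obtain j where j: "j < length as" "a = as ! j" by (auto simp: in_set_conv_nth)
        have "c (\<lambda>i. if i = j then 1 else 0) = (\<Sum>i<length as. if i = j then monomial a else 0)"
          unfolding c_def using j by (intro sum.cong) auto
        then have "c (\<lambda>i. if i = j then 1 else 0) = monomial a" using j by simp
        then show "monomial a \<in> range c" by (metis rangeI)
      qed
    qed
  qed
  finally show ?thesis .
qed

text \<open>Families of nonconstant, pairwise coprime monomials. By the next lemma the generators of a monomial
  complete intersection are of this kind.\<close>

definition coprime_exponents :: "('n \<Rightarrow>\<^sub>0 nat) set \<Rightarrow> bool" where
  "coprime_exponents A \<longleftrightarrow> finite A \<and> 0 \<notin> A \<and>
     (\<forall>a\<in>A. \<forall>b\<in>A. a \<noteq> b \<longrightarrow> Poly_Mapping.keys a \<inter> Poly_Mapping.keys b = {})"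

lemma coprime_exponents_keys_nonempty:
  "coprime_exponents A \<Longrightarrow> a \<in> A \<Longrightarrow> \<exists>i. i \<in> Poly_Mapping.keys a"
  by (metis coprime_exponents_def in_keys_iff lookup_zero poly_mapping_eqI)

lemma coprime_exponents_eqI:
  "coprime_exponents A \<Longrightarrow> a \<in> A \<Longrightarrow> b \<in> A \<Longrightarrow> i \<in> Poly_Mapping.keys a \<Longrightarrow>
   i \<in> Poly_Mapping.keys b \<Longrightarrow> a = b"
  unfolding coprime_exponents_def by blast

lemma coprime_exponents_subset: "coprime_exponents A \<Longrightarrow> B \<subseteq> A \<Longrightarrow> coprime_exponents B"
  unfolding coprime_exponents_def by (meson finite_subset subsetD)

text \<open>If \<open>x\<^sub>s\<close> divides both \<open>m\<^sub>i\<close> and an earlier \<open>m\<^sub>j\<close>, then \<open>m\<^sub>i \<cdot> (m\<^sub>j / x\<^sub>s)\<close> is a multiple of \<open>m\<^sub>j\<close>, so regularity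
  puts \<open>m\<^sub>j / x\<^sub>s\<close> into the ideal of \<open>m\<^sub>0, \<dots>, m\<^bsub>i-1\<^esub>\<close>. It is therefore divisible by some \<open>m\<^sub>k\<close> with \<open>k \<noteq> j\<close>,
  which by induction is coprime to \<open>m\<^sub>j\<close>; hence \<open>m\<^sub>k = 1\<close>, contrary to properness.\<close>

lemma regular_monomials_coprime:
  fixes as :: "('n::finite \<Rightarrow>\<^sub>0 nat) list"
  assumes "regular_sequence polyring (polyring :: (('n, 'k::field) mpol, _) module) (map monomial as)"
  shows "coprime_exponents (set as)"
proof -
  have ne: "monomial_ideal (set as) \<noteq> (UNIV :: ('n, 'k) mpol set)"
    using assms by (simp add: regular_sequence_def seq_submodule_monomials)
  have zero: "0 \<notin> set as"
  proof
    assume "0 \<in> set as"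
    then have "monomial_ideal (set as) = (UNIV :: ('n, 'k) mpol set)"
      by (auto simp: monomial_ideal_def exp_le_def intro!: bexI [of _ 0])
    then show False using ne by simp
  qed
  have reg: "monomial b \<in> (monomial_ideal (set (take i as)) :: ('n, 'k) mpol set)"
    if "i < length as" "monomial (as ! i + b) \<in> (monomial_ideal (set (take i as)) :: ('n, 'k) mpol set)"
    for i b
    using assms that
    by (auto simp: regular_sequence_def seq_submodule_monomials take_map simp flip: monomial_mult)
  have disj: "Poly_Mapping.keys (as ! i) \<inter> Poly_Mapping.keys (as ! j) = {}"
    if "j < i" "i < length as" for i j
    using that
  proof (induction i arbitrary: j rule: less_induct)
    case (less i)
    show ?case
    proof (rule ccontr)
      assume "Poly_Mapping.keys (as ! i) \<inter> Poly_Mapping.keys (as ! j) \<noteq> {}"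
      then obtain s where s: "Poly_Mapping.lookup (as ! i) s \<noteq> 0" "Poly_Mapping.lookup (as ! j) s \<noteq> 0"
        by (auto simp: in_keys_iff)
      define b where "b = as ! j - Poly_Mapping.single s 1"
      have nth_take: "k < i \<Longrightarrow> as ! k \<in> set (take i as)" for k
        using less.prems by (auto simp: in_set_conv_nth intro!: exI [of _ k])
      have "as ! j \<preceq> as ! i + b"
        using s by (auto simp: exp_le_def b_def lookup_add lookup_minus lookup_single when_def)
      then have "monomial (as ! i + b) \<in> (monomial_ideal (set (take i as)) :: ('n, 'k) mpol set)"
        using nth_take [OF less.prems(1)] by (auto simp: monomial_in_monomial_ideal)
      then have "monomial b \<in> (monomial_ideal (set (take i as)) :: ('n, 'k) mpol set)"
        using reg less.prems(2) by blast
      then obtain k where k: "k < i" "as ! k \<preceq> b"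
        by (auto simp: monomial_in_monomial_ideal in_set_conv_nth)
      have bj: "b \<preceq> as ! j" by (auto simp: exp_le_def b_def lookup_minus)
      have "k \<noteq> j"
      proof
        assume "k = j"
        then have "Poly_Mapping.lookup (as ! j) s \<le> Poly_Mapping.lookup b s"
          using k by (simp add: exp_le_def)
        then show False using s by (simp add: b_def lookup_minus)
      qed
      then have "Poly_Mapping.keys (as ! k) \<inter> Poly_Mapping.keys (as ! j) = {}"
        using less.IH [of k j] less.IH [of j k] k(1) less.prems
        by (cases "j < k") (auto simp: Int_commute)
      moreover have "Poly_Mapping.keys (as ! k) \<subseteq> Poly_Mapping.keys (as ! j)"
        using exp_le_keys exp_le_trans k(2) bj by blast
      ultimately have "Poly_Mapping.keys (as ! k) = {}" by blast
      then have "as ! k = 0"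
        by (intro poly_mapping_eqI) (simp flip: not_in_keys_iff_lookup_eq_zero)
      then show False
        using zero k(1) less.prems by (metis less_trans nth_mem)
    qed
  qed
  have "Poly_Mapping.keys a \<inter> Poly_Mapping.keys b = {}"
    if ab: "a \<in> set as" "b \<in> set as" "a \<noteq> b" for a b
  proof -
    obtain i j where ij: "i < length as" "j < length as" "a = as ! i" "b = as ! j"
      using ab by (auto simp: in_set_conv_nth)
    then have "i \<noteq> j" using ab by auto
    then show ?thesis
      using disj [of i j] disj [of j i] ij by (cases "i < j") (auto simp: Int_commute)
  qed
  then show ?thesis using zero by (auto simp: coprime_exponents_def)
qed

lemma monomial_complete_intersectionE:
  fixes I :: "('n::finite, 'k::field) mpol set"
  assumes "monomial_complete_intersection I"
  obtains A where "coprime_exponents A" "I = monomial_ideal A"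
proof -
  obtain us where us: "set us \<subseteq> range monomial"
    "regular_sequence polyring (polyring :: (('n, 'k) mpol, _) module) us" "I = Idl\<^bsub>polyring\<^esub> (set us)"
    using assms unfolding monomial_complete_intersection_def by blast
  have "us \<in> lists (range monomial)" using us(1) by auto
  then obtain as where "us = map monomial as" unfolding lists_image by auto
  then show ?thesis
    using us(3) regular_monomials_coprime [of as, where 'k = 'k] us(2) that [of "set as"]
    by (simp add: Idl_monomial)
qed

section \<open>Coprime families of monomials and their transversals\<close>

text \<open>The sum of all exponent vectors in \<open>W\<close> is the exponent \<open>\<delta>\<close> of the product of the monomials; it is the
  multidegree in which the homology classes below live.\<close>

lemma lookup_sum_coprime:
  assumes "coprime_exponents W" "w \<in> W" "i \<in> Poly_Mapping.keys w"
  shows "Poly_Mapping.lookup (\<Sum>W) i = Poly_Mapping.lookup w i"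
proof -
  have "Poly_Mapping.lookup (\<Sum>W) i = (\<Sum>v\<in>W. if v = w then Poly_Mapping.lookup w i else 0)"
    unfolding lookup_sum
    using assms by (intro sum.cong)
      (auto simp: in_keys_iff dest: coprime_exponents_eqI [OF assms(1,2) _ assms(3)])
  then show ?thesis using assms(1,2) by (simp add: coprime_exponents_def)
qed

lemma keys_sum_coprime:
  assumes "coprime_exponents W"
  shows "Poly_Mapping.keys (\<Sum>W) = (\<Union>w\<in>W. Poly_Mapping.keys w)"
proof (rule Set.set_eqI, rule iffI)
  fix i assume "i \<in> Poly_Mapping.keys (\<Sum>W)"
  then have "(\<Sum>w\<in>W. Poly_Mapping.lookup w i) \<noteq> 0" by (simp add: in_keys_iff lookup_sum)
  then show "i \<in> (\<Union>w\<in>W. Poly_Mapping.keys w)"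
    by (metis (no_types, lifting) UN_I in_keys_iff sum.neutral)
next
  fix i assume "i \<in> (\<Union>w\<in>W. Poly_Mapping.keys w)"
  then obtain w where w: "w \<in> W" "i \<in> Poly_Mapping.keys w" by blast
  then show "i \<in> Poly_Mapping.keys (\<Sum>W)"
    using lookup_sum_coprime [OF assms w] by (simp add: in_keys_iff)
qed

lemma not_exp_le_sum_diff:
  assumes "coprime_exponents W" "w \<in> W" "i \<in> Poly_Mapping.keys w" "i \<in> T"
  shows "\<not> w \<preceq> \<Sum>W - exp_of_set T"
proof
  assume "w \<preceq> \<Sum>W - exp_of_set T"
  then have "Poly_Mapping.lookup w i \<le> Poly_Mapping.lookup w i - 1"
    using lookup_sum_coprime [OF assms(1-3)] assms(4)
    by (auto simp: exp_le_def lookup_minus lookup_exp_of_set dest: spec [of _ i])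
  then show False using assms(3) by (simp add: in_keys_iff)
qed

lemma coprime_choice_eq:
  assumes "coprime_exponents W" "\<And>w. w \<in> W \<Longrightarrow> t w \<in> Poly_Mapping.keys w"
    and "w \<in> W" "i \<in> Poly_Mapping.keys w" "i \<in> t ` W"
  shows "i = t w"
  using assms coprime_exponents_eqI [OF assms(1)] by blast

text \<open>Removing one variable \<open>t w\<close> from each factor \<open>w\<close> of the product of all monomials in \<open>W\<close> leaves a
  monomial outside the ideal, but restoring any single one of the variables completes a factor again.
  This makes the chain with the coefficient \<open>x\<^sup>\<delta> / x\<^sub>T\<close> at \<open>T = t ` W\<close> a cycle modulo the ideal.\<close>

lemma var_mult_in_monomial_ideal:
  assumes W: "coprime_exponents W" "\<And>w. w \<in> W \<Longrightarrow> t w \<in> Poly_Mapping.keys w" and a: "a \<in> t ` W"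
  shows "var a * monomial (\<Sum>W - exp_of_set (t ` W)) \<in> monomial_ideal W"
proof -
  obtain w where w: "w \<in> W" "a = t w" using a by blast
  have "w \<preceq> Poly_Mapping.single a 1 + (\<Sum>W - exp_of_set (t ` W))"
    unfolding exp_le_def
  proof
    fix i
    show "Poly_Mapping.lookup w i \<le>
      Poly_Mapping.lookup (Poly_Mapping.single a 1 + (\<Sum>W - exp_of_set (t ` W))) i"
    proof (cases "i \<in> Poly_Mapping.keys w")
      case True
      then show ?thesis
        using lookup_sum_coprime [OF W(1) w(1) True] coprime_choice_eq [OF W w(1) True] w(2)
        by (auto simp: lookup_add lookup_minus lookup_exp_of_set lookup_single when_def)
    next
      case False
      then show ?thesis by (simp add: in_keys_iff)
    qed
  qed
  then show ?thesis
    using w(1) by (auto simp: var_def monomial_mult monomial_in_monomial_ideal)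
qed

text \<open>The blocks are the supports of the monomials in \<open>W\<close>.\<close>

lemma block_colouring:
  fixes W :: "('n \<Rightarrow>\<^sub>0 nat) set"
  assumes W: "coprime_exponents W"
  defines "X \<equiv> \<Union>w\<in>W. Poly_Mapping.keys w"
  obtains col :: "'n \<Rightarrow> nat" where "card (col ` X) = card W"
    "\<And>T w. T \<in> transversals col X \<Longrightarrow> w \<in> W \<Longrightarrow> \<exists>i\<in>T. i \<in> Poly_Mapping.keys w"
    "\<And>t. (\<And>w. w \<in> W \<Longrightarrow> t w \<in> Poly_Mapping.keys w) \<Longrightarrow> t ` W \<in> transversals col X"
proof -
  have "finite W" using W by (simp add: coprime_exponents_def)
  then obtain e :: "('n \<Rightarrow>\<^sub>0 nat) \<Rightarrow> nat" where e: "inj_on e W"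
    by (metis finite_imp_inj_to_nat_seg)
  define col where "col i = e (THE w. w \<in> W \<and> i \<in> Poly_Mapping.keys w)" for i
  have col: "col i = e w" if "w \<in> W" "i \<in> Poly_Mapping.keys w" for i w
    unfolding col_def using that coprime_exponents_eqI [OF W] 
    by (intro arg_cong [of _ _ e] the_equality) auto
  have im: "col ` X = e ` W"
  proof
    show "col ` X \<subseteq> e ` W" by (auto simp: X_def col)
    show "e ` W \<subseteq> col ` X"
    proof
      fix k assume "k \<in> e ` W"
      then obtain w where w: "w \<in> W" "k = e w" by blast
      then obtain i where "i \<in> Poly_Mapping.keys w" using coprime_exponents_keys_nonempty [OF W] by blast
      then show "k \<in> col ` X" using w col [of w i] by (auto simp: X_def intro!: image_eqI [of _ _ i])
    qed
  qed
  show thesis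
  proof
    show "card (col ` X) = card W" unfolding im by (rule card_image [OF e])
  next
    fix T w assume T: "T \<in> transversals col X" and w: "w \<in> W"
    then have "e w \<in> col ` T" using im by (auto simp: transversals_def bij_betw_def)
    then obtain i where i: "i \<in> T" "col i = e w" by auto
    then obtain v where v: "v \<in> W" "i \<in> Poly_Mapping.keys v"
      using T by (auto simp: transversals_def X_def)
    then have "v = w" using i col e w by (auto simp: inj_on_def)
    then show "\<exists>i\<in>T. i \<in> Poly_Mapping.keys w" using i v by blast
  next
    fix t assume t: "\<And>w. w \<in> W \<Longrightarrow> t w \<in> Poly_Mapping.keys w"
    then have c: "col (t w) = e w" if "w \<in> W" for w using that col by blast
    have "inj_on col (t ` W)" using c e by (auto simp: inj_on_def)
    moreover have "col ` (t ` W) = e ` W" using c by (force simp: image_image)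
    ultimately show "t ` W \<in> transversals col X"
      using t im by (auto simp: transversals_def bij_betw_def X_def)
  qed
qed

text \<open>Two monomials of \<open>A\<close> cannot be multiples of the same \<open>b \<in> B\<close>, since they are coprime and \<open>b \<noteq> 1\<close>.
  So \<open>B\<close> has at least as many elements as \<open>A\<close>, with an element of \<open>B\<close> below each element of \<open>A\<close>.\<close>

lemma divisor_assignment:
  assumes "coprime_exponents A" "coprime_exponents B"
    and sub: "monomial_ideal A \<subseteq> (monomial_ideal B :: ('n, 'k::field) mpol set)"
  obtains \<sigma> where "\<And>a. a \<in> A \<Longrightarrow> \<sigma> a \<in> B" "\<And>a. a \<in> A \<Longrightarrow> \<sigma> a \<preceq> a" "inj_on \<sigma> A"
proof -
  have "\<exists>b\<in>B. b \<preceq> a" if "a \<in> A" for a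
  proof -
    have "(monomial a :: ('n, 'k) mpol) \<in> monomial_ideal B"
      using sub monomial_in_monomial_idealI [OF that] by blast
    then show ?thesis by (simp add: monomial_in_monomial_ideal)
  qed
  then obtain \<sigma> where \<sigma>: "\<And>a. a \<in> A \<Longrightarrow> \<sigma> a \<in> B" "\<And>a. a \<in> A \<Longrightarrow> \<sigma> a \<preceq> a" by metis
  have "inj_on \<sigma> A"
  proof (rule inj_onI)
    fix a b assume ab: "a \<in> A" "b \<in> A" "\<sigma> a = \<sigma> b"
    obtain i where "i \<in> Poly_Mapping.keys (\<sigma> a)"
      using coprime_exponents_keys_nonempty [OF assms(2) \<sigma>(1) [OF ab(1)]] by blast
    then have "i \<in> Poly_Mapping.keys a" "i \<in> Poly_Mapping.keys b"
      using exp_le_keys [OF \<sigma>(2)] ab by (blast, metis subsetD)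
    then show "a = b" using coprime_exponents_eqI [OF assms(1)] ab by blast
  qed
  then show ?thesis using \<sigma> that by blast
qed

text \<open>The blocks are the supports of the generators of \<open>I\<close>. The class comes from \<open>S/I\<close>; it can be
  represented by a chain in \<open>J\<close> because the proper divisor \<open>b0\<close> of \<open>a0\<close> leaves room for removing a variable
  from \<open>a0\<close> without leaving \<open>J\<close>.\<close>

lemma not_koszul_exact_equal_card:
  fixes A B :: "('n::finite \<Rightarrow>\<^sub>0 nat) set"
  assumes A: "coprime_exponents A" and "a0 \<in> A" "b0 \<in> B" "b0 \<preceq> a0" "b0 \<noteq> a0"
  shows "\<exists>r. inj r \<and> \<not> koszul_exact r var (monomial_ideal B) (monomial_ideal A :: ('n, 'k::field) mpol set) (card A)"
proof -
  let ?X = "\<Union>a\<in>A. Poly_Mapping.keys a"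
  obtain col where card: "card (col ` ?X) = card A"
    and hit: "\<And>T w. T \<in> transversals col ?X \<Longrightarrow> w \<in> A \<Longrightarrow> \<exists>i\<in>T. i \<in> Poly_Mapping.keys w"
    and choice: "\<And>t. (\<And>w. w \<in> A \<Longrightarrow> t w \<in> Poly_Mapping.keys w) \<Longrightarrow> t ` A \<in> transversals col ?X"
    using block_colouring [OF A] by metis
  obtain r :: "'n \<Rightarrow> nat" where r: "inj r" "\<And>a b. col a < col b \<Longrightarrow> r a < r b"
    using block_order by metis
  obtain j where "\<not> Poly_Mapping.lookup a0 j \<le> Poly_Mapping.lookup b0 j"
    using assms exp_le_antisym unfolding exp_le_def by blast
  then have j: "Poly_Mapping.lookup b0 j < Poly_Mapping.lookup a0 j" by simp
  \<comment> \<open>In the block of \<open>a0\<close> the transversal uses a variable with a smaller exponent in \<open>b0\<close>.\<close>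
  define t where "t w = (if w = a0 then j else SOME i. i \<in> Poly_Mapping.keys w)" for w
  have t: "t w \<in> Poly_Mapping.keys w" if "w \<in> A" for w
    using someI_ex [OF coprime_exponents_keys_nonempty [OF A that]] j
    by (auto simp: t_def in_keys_iff)
  have "b0 \<preceq> \<Sum>A - exp_of_set (t ` A)"
    unfolding exp_le_def
  proof
    fix i
    show "Poly_Mapping.lookup b0 i \<le> Poly_Mapping.lookup (\<Sum>A - exp_of_set (t ` A)) i"
    proof (cases "i \<in> Poly_Mapping.keys a0")
      case True
      have "Poly_Mapping.lookup b0 i \<le> Poly_Mapping.lookup a0 i"
        using \<open>b0 \<preceq> a0\<close> by (simp add: exp_le_def)
      moreover have "i \<in> t ` A \<Longrightarrow> i = j"
        using coprime_choice_eq [OF A t \<open>a0 \<in> A\<close> True] by (simp add: t_def)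
      ultimately show ?thesis
        using lookup_sum_coprime [OF A \<open>a0 \<in> A\<close> True] j
        by (auto simp: lookup_minus lookup_exp_of_set)
    next
      case False
      then show ?thesis
        using exp_le_keys [OF \<open>b0 \<preceq> a0\<close>] by (metis in_keys_iff le0 subsetD)
    qed
  qed
  then have J: "monomial (\<Sum>A - exp_of_set (t ` A)) \<in> (monomial_ideal B :: ('n, 'k) mpol set)"
    using \<open>b0 \<in> B\<close> by (auto simp: monomial_in_monomial_ideal)
  have "\<not> koszul_exact r var (monomial_ideal B) (monomial_ideal A :: ('n, 'k) mpol set) (card (col ` ?X))"
  proof (rule not_koszul_exact_direct [where \<delta> = "\<Sum>A" and T = "t ` A"])
    show "t ` A \<in> transversals col ?X" by (rule choice [OF t])
    show "Poly_Mapping.lookup u (\<Sum>A - exp_of_set T) = 0"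
      if "u \<in> (monomial_ideal A :: ('n, 'k) mpol set)" "T \<in> transversals col ?X" for u T
      by (rule lookup_monomial_ideal [OF that(1)])
        (use hit [OF that(2)] not_exp_le_sum_diff [OF A] in blast)
    show "var a * monomial (\<Sum>A - exp_of_set (t ` A)) \<in> (monomial_ideal A :: ('n, 'k) mpol set)"
      if "a \<in> t ` A" for a
      using var_mult_in_monomial_ideal [OF A t that] by simp
    show "Poly_Mapping.lookup (\<Sum>A) a \<noteq> 0" if "a \<in> ?X" for a
      using that unfolding keys_sum_coprime [OF A, symmetric] in_keys_iff .
    show "Poly_Mapping.lookup (\<Sum>A) a = 0" if "a \<notin> ?X" for a
      using that unfolding keys_sum_coprime [OF A, symmetric] by (simp add: in_keys_iff)
  qed (fact r J ideal_set_monomial_ideal)+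
  then show ?thesis using r(1) card by auto
qed

text \<open>The blocks are the supports of all generators of \<open>J\<close> except \<open>k\<close>. Removing a transversal from the product
  of all generators leaves a monomial that is divisible by no generator of \<open>J\<close> other than \<open>k\<close>, and so
  is not in \<open>I\<close>; removing a further variable of \<open>k\<close> leaves a monomial that is not even in \<open>J\<close>. These
  are the two conditions for the functional to be well defined.\<close>

lemma not_koszul_exact_extra_generator:
  fixes A B :: "('n::finite \<Rightarrow>\<^sub>0 nat) set"
  assumes B: "coprime_exponents B" and k: "k \<in> B"
    and A: "\<And>a. a \<in> A \<Longrightarrow> \<exists>b\<in>B - {k}. b \<preceq> a"
  shows "\<exists>r. inj r \<and> \<not> koszul_exact r var (monomial_ideal B) (monomial_ideal A :: ('n, 'k::field) mpol set) (card B - 1)"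
proof -
  define W where "W = B - {k}"
  have W: "coprime_exponents W" unfolding W_def by (rule coprime_exponents_subset [OF B]) blast
  have BW: "B = insert k W" using k by (auto simp: W_def)
  have cW: "card W = card B - 1" using B k by (simp add: W_def coprime_exponents_def)
  let ?X = "\<Union>w\<in>W. Poly_Mapping.keys w"
  obtain col where card: "card (col ` ?X) = card W"
    and hit: "\<And>T w. T \<in> transversals col ?X \<Longrightarrow> w \<in> W \<Longrightarrow> \<exists>i\<in>T. i \<in> Poly_Mapping.keys w"
    and choice: "\<And>t. (\<And>w. w \<in> W \<Longrightarrow> t w \<in> Poly_Mapping.keys w) \<Longrightarrow> t ` W \<in> transversals col ?X"
    using block_colouring [OF W] by metis
  obtain r :: "'n \<Rightarrow> nat" where r: "inj r" "\<And>a b. col a < col b \<Longrightarrow> r a < r b"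
    using block_order by metis
  define t where "t w = (SOME i. i \<in> Poly_Mapping.keys w)" for w :: "'n \<Rightarrow>\<^sub>0 nat"
  have t: "t w \<in> Poly_Mapping.keys w" if "w \<in> B" for w
    unfolding t_def by (rule someI_ex [OF coprime_exponents_keys_nonempty [OF B that]])
  have tW: "t w \<in> Poly_Mapping.keys w" if "w \<in> W" for w using t that by (simp add: BW)
  have keys: "Poly_Mapping.lookup (\<Sum>B) i \<noteq> 0 \<longleftrightarrow> i \<in> Poly_Mapping.keys k \<or> i \<in> ?X" for i
    using keys_sum_coprime [OF B] unfolding in_keys_iff [symmetric] by (simp add: BW)
  have "\<not> koszul_exact r var (monomial_ideal B) (monomial_ideal A :: ('n, 'k) mpol set) (card (col ` ?X))"
  proof (rule not_koszul_exact_connecting [where \<delta> = "\<Sum>B" and T = "t ` W" and e = "t k"])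
    show "t ` W \<in> transversals col ?X" by (rule choice [OF tW])
    show "Poly_Mapping.lookup (\<Sum>B) a \<noteq> 0" if "a \<in> ?X" for a using that keys by blast
    show "Poly_Mapping.lookup (\<Sum>B) (t k) \<noteq> 0" using t k keys by blast
    show "t k \<notin> ?X"
      using t [OF k] coprime_exponents_eqI [OF B k] by (fastforce simp: W_def)
    show "Poly_Mapping.lookup u (\<Sum>B - exp_of_set (insert a T)) = 0"
      if "u \<in> (monomial_ideal B :: ('n, 'k) mpol set)" "T \<in> transversals col ?X" "a \<notin> ?X"
        "Poly_Mapping.lookup (\<Sum>B) a \<noteq> 0" for u T a
    proof (rule lookup_monomial_ideal [OF that(1)])
      fix b assume b: "b \<in> B"
      have "a \<in> Poly_Mapping.keys k" using that keys by blast
      then have "\<exists>i\<in>insert a T. i \<in> Poly_Mapping.keys b"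
        using hit [OF that(2)] b by (auto simp: BW)
      then show "\<not> b \<preceq> \<Sum>B - exp_of_set (insert a T)"
        using not_exp_le_sum_diff [OF B b] by blast
    qed
    show "Poly_Mapping.lookup u (\<Sum>B - exp_of_set T) = 0"
      if "u \<in> (monomial_ideal A :: ('n, 'k) mpol set)" "T \<in> transversals col ?X" for u T
    proof (rule lookup_monomial_ideal [OF that(1)])
      fix a assume "a \<in> A"
      then obtain b where b: "b \<in> W" "b \<preceq> a" using A by (auto simp: W_def)
      then have "\<not> b \<preceq> \<Sum>B - exp_of_set T"
        using hit [OF that(2) b(1)] not_exp_le_sum_diff [OF B, of b] by (auto simp: BW)
      then show "\<not> a \<preceq> \<Sum>B - exp_of_set T" using b exp_le_trans by blast
    qed
    show "var a * monomial (\<Sum>B - exp_of_set (insert (t k) (t ` W))) \<in> (monomial_ideal B :: ('n, 'k) mpol set)"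
      if "a \<in> insert (t k) (t ` W)" for a
      using var_mult_in_monomial_ideal [OF B t, of a] that by (simp add: BW)
  qed (fact r ideal_set_monomial_ideal)+
  then show ?thesis using r(1) card cW by auto
qed

text \<open>If \<open>I\<close> and \<open>J\<close> have equally many generators, some generator of \<open>J\<close> properly divides one of \<open>I\<close>, as
  otherwise the two ideals would be equal. If \<open>J\<close> has more, one of its generators is not assigned to
  any generator of \<open>I\<close>.\<close>

lemma not_koszul_exact_monomial_ideals:
  fixes A B :: "('n::finite \<Rightarrow>\<^sub>0 nat) set"
  assumes A: "coprime_exponents A" and B: "coprime_exponents B"
    and sub: "monomial_ideal A \<subset> (monomial_ideal B :: ('n, 'k::field) mpol set)"
  shows "\<exists>r. inj r \<and> \<not> koszul_exact r var (monomial_ideal B) (monomial_ideal A :: ('n, 'k) mpol set)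
    (max (card A) (card B - 1))"
proof -
  obtain \<sigma> where \<sigma>: "\<And>a. a \<in> A \<Longrightarrow> \<sigma> a \<in> B" "\<And>a. a \<in> A \<Longrightarrow> \<sigma> a \<preceq> a" "inj_on \<sigma> A"
    using divisor_assignment [OF A B psubset_imp_subset [OF sub]] by blast
  have fin: "finite A" "finite B" using A B by (auto simp: coprime_exponents_def)
  have im: "\<sigma> ` A \<subseteq> B" "card (\<sigma> ` A) = card A" using \<sigma> by (auto simp: card_image)
  then have le: "card A \<le> card B" using card_mono [OF fin(2) im(1)] by simp
  show ?thesis
  proof (cases "card A = card B")
    case True
    have "\<exists>a\<in>A. \<sigma> a \<noteq> a"
    proof (rule ccontr)
      assume "\<not> (\<exists>a\<in>A. \<sigma> a \<noteq> a)"
      then have "\<sigma> ` A = A" by auto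
      then have "A = B" using card_subset_eq [OF fin(2), of A] im True by simp
      then show False using sub by blast
    qed
    then obtain a where a: "a \<in> A" "\<sigma> a \<noteq> a" by blast
    have max: "max (card A) (card B - 1) = card A" using True by simp
    show ?thesis
      unfolding max by (rule not_koszul_exact_equal_card [OF A a(1) \<sigma>(1,2) [OF a(1)] a(2)])
  next
    case False
    then have "\<sigma> ` A \<noteq> B" using im(2) by auto
    then obtain k where k: "k \<in> B" "k \<notin> \<sigma> ` A" using im(1) by blast
    have max: "max (card A) (card B - 1) = card B - 1" using False le by simp
    have "\<exists>b\<in>B - {k}. b \<preceq> a" if "a \<in> A" for a
      using \<sigma>(1,2) [OF that] k(2) that by blast
    then show ?thesis
      unfolding max by (intro not_koszul_exact_extra_generator [OF B k(1)])
  qed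
qed

section \<open>Partitions into cones\<close>

text \<open>The exponents of the monomials in \<open>x\<^sup>a K[Z]\<close>, for \<open>p = (a, Z)\<close>.\<close>

definition cone :: "('n \<Rightarrow>\<^sub>0 nat) \<times> 'n set \<Rightarrow> ('n \<Rightarrow>\<^sub>0 nat) set" where
  "cone p = {b. fst p \<preceq> b \<and> (\<forall>i. i \<notin> snd p \<longrightarrow> Poly_Mapping.lookup b i = Poly_Mapping.lookup (fst p) i)}"

definition cone_partition :: "(('n \<Rightarrow>\<^sub>0 nat) \<times> 'n set) set \<Rightarrow> ('n \<Rightarrow>\<^sub>0 nat) set \<Rightarrow> bool" where
  "cone_partition C E \<longleftrightarrow> finite C \<and> disjoint_family_on cone C \<and> (\<Union>p\<in>C. cone p) = E"

definition cone_decomposable :: "nat \<Rightarrow> ('n \<Rightarrow>\<^sub>0 nat) set \<Rightarrow> bool" where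
  "cone_decomposable d E \<longleftrightarrow> (\<exists>C. cone_partition C E \<and> (\<forall>p\<in>C. d \<le> card (snd p)))"

lemma cone_decomposable_empty: "cone_decomposable d {}"
  unfolding cone_decomposable_def cone_partition_def
  by (intro exI [of _ "{}"]) (simp add: disjoint_family_on_def)

lemma cone_decomposable_cone: "d \<le> card (snd p) \<Longrightarrow> cone_decomposable d (cone p)"
  unfolding cone_decomposable_def cone_partition_def
  by (intro exI [of _ "{p}"]) (simp add: disjoint_family_on_def)

lemma cone_decomposable_mono: "cone_decomposable d E \<Longrightarrow> d' \<le> d \<Longrightarrow> cone_decomposable d' E"
  unfolding cone_decomposable_def by (meson le_trans)

lemma cone_nonempty: "fst p \<in> cone p"
  by (simp add: cone_def)

lemma cone_decomposable_UN:
  assumes "finite K" "\<And>k. k \<in> K \<Longrightarrow> cone_decomposable d (E k)" "disjoint_family_on E K"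
  shows "cone_decomposable d (\<Union>k\<in>K. E k)"
proof -
  obtain C where C: "\<And>k. k \<in> K \<Longrightarrow> cone_partition (C k) (E k)"
    "\<And>k p. k \<in> K \<Longrightarrow> p \<in> C k \<Longrightarrow> d \<le> card (snd p)"
    using assms(2) unfolding cone_decomposable_def by metis
  have sub: "cone p \<subseteq> E k" if "k \<in> K" "p \<in> C k" for k p
    using C(1) [OF that(1)] that(2) by (auto simp: cone_partition_def)
  have "cone p \<inter> cone q = {}"
    if "k \<in> K" "l \<in> K" "p \<in> C k" "q \<in> C l" "p \<noteq> q" for k l p q
  proof (cases "k = l")
    case True
    then show ?thesis
      using C(1) [OF that(1)] that by (auto simp: cone_partition_def disjoint_family_on_def)
  next
    case False
    then have "E k \<inter> E l = {}" using assms(3) that by (auto simp: disjoint_family_on_def)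
    then show ?thesis using sub that by blast
  qed
  then have "disjoint_family_on cone (\<Union>k\<in>K. C k)"
    unfolding disjoint_family_on_def by blast
  then have "cone_partition (\<Union>k\<in>K. C k) (\<Union>k\<in>K. E k)"
    using C(1) assms(1) by (auto simp: cone_partition_def)
  then show ?thesis unfolding cone_decomposable_def using C(2) by blast
qed

lemma cone_decomposable_Un:
  assumes "cone_decomposable d E" "cone_decomposable d F" "E \<inter> F = {}"
  shows "cone_decomposable d (E \<union> F)"
proof -
  have "cone_decomposable d (\<Union>b\<in>UNIV. if b then E else F)"
    using assms by (intro cone_decomposable_UN) (auto simp: disjoint_family_on_def)
  then show ?thesis by (simp add: UNIV_bool Un_commute)
qed

text \<open>The monomials of the cone with the least possible exponent of \<open>x\<^sub>j\<close>, and the others.\<close>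

lemma cone_split:
  fixes a :: "'n::finite \<Rightarrow>\<^sub>0 nat"
  assumes "j \<in> Z"
  shows "cone (a, Z) = cone (a, Z - {j}) \<union> cone (a + Poly_Mapping.single j 1, Z)"
    "cone (a, Z - {j}) \<inter> cone (a + Poly_Mapping.single j 1, Z) = {}"
proof -
  have *: "a + Poly_Mapping.single j 1 \<preceq> b \<longleftrightarrow> a \<preceq> b \<and> Poly_Mapping.lookup b j \<noteq> Poly_Mapping.lookup a j" for b
    unfolding exp_le_def
    by (auto simp: lookup_add lookup_single when_def Suc_le_eq order_less_le
        split: if_splits dest: spec [of _ j])
  show "cone (a, Z) = cone (a, Z - {j}) \<union> cone (a + Poly_Mapping.single j 1, Z)"
    using assms unfolding cone_def fst_conv snd_conv *
    by (auto simp: lookup_add lookup_single when_def)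
  show "cone (a, Z - {j}) \<inter> cone (a + Poly_Mapping.single j 1, Z) = {}"
    unfolding cone_def fst_conv snd_conv * by auto
qed

text \<open>Removing the multiples of one monomial \<open>w\<close> from a cone costs at most one dimension. If \<open>w\<close> does not
  divide the apex, its exponent in some \<open>x\<^sub>j\<close> is too large; the slice of the cone with the least
  exponent of \<open>x\<^sub>j\<close> contains no multiple of \<open>w\<close>, and the rest is a cone whose apex is closer to \<open>w\<close>.\<close>

lemma cone_decomposable_remove_one:
  fixes w :: "'n::finite \<Rightarrow>\<^sub>0 nat"
  shows "cone_decomposable (card Z - 1) {b \<in> cone (a, Z). \<not> w \<preceq> b}"
proof (induction "\<Sum>i\<in>UNIV. Poly_Mapping.lookup w i - Poly_Mapping.lookup a i" arbitrary: a rule: less_induct)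
  case less
  show ?case
  proof (cases "w \<preceq> a")
    case True
    then have eq: "{b \<in> cone (a, Z). \<not> w \<preceq> b} = {}"
      using exp_le_trans [OF True] by (auto simp: cone_def)
    show ?thesis unfolding eq by (rule cone_decomposable_empty)
  next
    case False
    then obtain j where j: "Poly_Mapping.lookup a j < Poly_Mapping.lookup w j"
      by (auto simp: exp_le_def not_le)
    have avoid: "\<not> w \<preceq> b" if "Poly_Mapping.lookup b j = Poly_Mapping.lookup a j" for b
      using that j unfolding exp_le_def by (metis not_less)
    show ?thesis
    proof (cases "j \<in> Z")
      case False
      then have eq: "{b \<in> cone (a, Z). \<not> w \<preceq> b} = cone (a, Z)"
        using avoid by (auto simp: cone_def)
      show ?thesis unfolding eq by (rule cone_decomposable_cone) simp
    next
      case True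
      let ?a = "a + Poly_Mapping.single j 1"
      have eq: "{b \<in> cone (a, Z). \<not> w \<preceq> b} =
        cone (a, Z - {j}) \<union> {b \<in> cone (?a, Z). \<not> w \<preceq> b}"
        unfolding cone_split(1) [OF True, of a] using avoid by (auto simp: cone_def [of "(a, Z - {j})"])
      have slice: "cone_decomposable (card Z - 1) (cone (a, Z - {j}))"
        using True by (intro cone_decomposable_cone) simp
      have rest: "cone_decomposable (card Z - 1) {b \<in> cone (?a, Z). \<not> w \<preceq> b}"
      proof (rule less)
        show "(\<Sum>i\<in>UNIV. Poly_Mapping.lookup w i - Poly_Mapping.lookup ?a i) <
          (\<Sum>i\<in>UNIV. Poly_Mapping.lookup w i - Poly_Mapping.lookup a i)"
        proof (rule sum_strict_mono_ex1)
          show "\<exists>i\<in>UNIV. Poly_Mapping.lookup w i - Poly_Mapping.lookup ?a i <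
              Poly_Mapping.lookup w i - Poly_Mapping.lookup a i"
            using j by (intro bexI [of _ j]) (simp_all add: lookup_add)
        qed (simp_all add: lookup_add diff_le_mono2)
      qed
      show ?thesis
        unfolding eq using cone_split(2) [OF True, of a]
        by (intro cone_decomposable_Un [OF slice rest]) blast
    qed
  qed
qed

lemma cone_decomposable_remove:
  fixes w :: "'n::finite \<Rightarrow>\<^sub>0 nat"
  assumes "cone_decomposable d E"
  shows "cone_decomposable (d - 1) {b \<in> E. \<not> w \<preceq> b}"
proof -
  obtain C where C: "cone_partition C E" "\<And>p. p \<in> C \<Longrightarrow> d \<le> card (snd p)"
    using assms unfolding cone_decomposable_def by blast
  have eq: "{b \<in> E. \<not> w \<preceq> b} = (\<Union>p\<in>C. {b \<in> cone p. \<not> w \<preceq> b})"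
    using C(1) by (auto simp: cone_partition_def)
  show ?thesis
    unfolding eq
  proof (rule cone_decomposable_UN)
    show "cone_decomposable (d - 1) {b \<in> cone p. \<not> w \<preceq> b}" if "p \<in> C" for p
    proof -
      have "d - 1 \<le> card (snd p) - 1" using C(2) [OF that] by (rule diff_le_mono)
      with cone_decomposable_remove_one [of "snd p" "fst p" w]
      show ?thesis unfolding prod.collapse by (rule cone_decomposable_mono)
    qed
    show "disjoint_family_on (\<lambda>p. {b \<in> cone p. \<not> w \<preceq> b}) C"
      unfolding disjoint_family_on_def
    proof (intro ballI impI)
      fix p q assume "p \<in> C" "q \<in> C" "p \<noteq> q"
      then have "cone p \<inter> cone q = {}"
        using C(1) by (simp add: cone_partition_def disjoint_family_on_def)
      then show "{b \<in> cone p. \<not> w \<preceq> b} \<inter> {b \<in> cone q. \<not> w \<preceq> b} = {}" by blast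
    qed
  qed (use C(1) in \<open>simp add: cone_partition_def\<close>)
qed

lemma cone_decomposable_remove_set:
  fixes W :: "('n::finite \<Rightarrow>\<^sub>0 nat) set"
  assumes "finite W" "cone_decomposable d E"
  shows "cone_decomposable (d - card W) {b \<in> E. \<forall>w\<in>W. \<not> w \<preceq> b}"
  using assms(1)
proof (induction W rule: finite_induct)
  case empty
  then show ?case using assms(2) by simp
next
  case (insert w W)
  have eq: "{b \<in> E. \<forall>v\<in>insert w W. \<not> v \<preceq> b} = {b \<in> {b \<in> E. \<forall>v\<in>W. \<not> v \<preceq> b}. \<not> w \<preceq> b}"
    by auto
  have card: "d - card (insert w W) = d - card W - 1" using insert.hyps by simp
  show ?case unfolding eq card by (rule cone_decomposable_remove [OF insert.IH])
qed

text \<open>A monomial of \<open>J\<close> is sorted by the first generator \<open>v\<^sub>k\<close> of \<open>J\<close> that divides it. It then has to avoid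
  \<open>v\<^sub>0, \<dots>, v\<^bsub>k-1\<^esub>\<close> and the generators of \<open>I\<close>; among the latter, those with index below \<open>k\<close> are avoided
  automatically, being multiples of \<open>v\<^sub>0, \<dots>, v\<^bsub>k-1\<^esub>\<close>. So at most
  \<open>max (length us) (length vs - 1)\<close> monomials have to be removed from the cone of \<open>v\<^sub>k\<close>.\<close>

lemma cone_decomposable_difference_lists:
  fixes us vs :: "('n::finite \<Rightarrow>\<^sub>0 nat) list"
  assumes len: "length us \<le> length vs" and div: "\<And>i. i < length us \<Longrightarrow> vs ! i \<preceq> us ! i"
  shows "cone_decomposable (card (UNIV :: 'n set) - max (length us) (length vs - 1))
    {b. (\<exists>v\<in>set vs. v \<preceq> b) \<and> \<not> (\<exists>u\<in>set us. u \<preceq> b)}"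
proof -
  define W where "W k = set (take k vs) \<union> set (drop k us)" for k
  define E where "E k = {b \<in> cone (vs ! k, UNIV). \<forall>w\<in>W k. \<not> w \<preceq> b}" for k
  have E: "b \<in> E k \<longleftrightarrow> vs ! k \<preceq> b \<and> (\<forall>i<k. i < length vs \<longrightarrow> \<not> vs ! i \<preceq> b) \<and>
      (\<forall>i<length us. k \<le> i \<longrightarrow> \<not> us ! i \<preceq> b)" for b k
  proof -
    have "(\<forall>w\<in>set (take k vs). \<not> w \<preceq> b) \<longleftrightarrow> (\<forall>i<k. i < length vs \<longrightarrow> \<not> vs ! i \<preceq> b)"
      by (auto simp: all_set_conv_all_nth)
    moreover have "(\<forall>w\<in>set (drop k us). \<not> w \<preceq> b) \<longleftrightarrow> (\<forall>i<length us. k \<le> i \<longrightarrow> \<not> us ! i \<preceq> b)"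
      by (auto simp: all_set_conv_all_nth dest: le_Suc_ex)
    ultimately show ?thesis by (simp add: E_def W_def cone_def ball_Un)
  qed
  have "cone_decomposable (card (UNIV :: 'n set) - max (length us) (length vs - 1))
    (\<Union>k\<in>{..<length vs}. E k)"
  proof (rule cone_decomposable_UN)
    fix k assume k: "k \<in> {..<length vs}"
    have "card (W k) \<le> length (take k vs) + length (drop k us)"
      unfolding W_def by (meson add_mono card_Un_le card_length le_trans)
    also have "\<dots> \<le> max (length us) (length vs - 1)" using k by auto
    finally have le: "card (W k) \<le> max (length us) (length vs - 1)" .
    have "cone_decomposable (card (UNIV :: 'n set) - card (W k)) (E k)"
      unfolding E_def
      by (intro cone_decomposable_remove_set cone_decomposable_cone) (simp_all add: W_def)
    then show "cone_decomposable (card (UNIV :: 'n set) - max (length us) (length vs - 1)) (E k)"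
      by (rule cone_decomposable_mono) (rule diff_le_mono2 [OF le])
  next
    show "disjoint_family_on E {..<length vs}"
      unfolding disjoint_family_on_def
    proof (intro ballI impI)
      fix k l assume "k \<in> {..<length vs}" "l \<in> {..<length vs}" "k \<noteq> l"
      then show "E k \<inter> E l = {}"
        by (cases k l rule: linorder_cases) (auto simp: E)
    qed
  qed simp
  moreover have "(\<Union>k\<in>{..<length vs}. E k) = {b. (\<exists>v\<in>set vs. v \<preceq> b) \<and> \<not> (\<exists>u\<in>set us. u \<preceq> b)}"
  proof (rule Set.set_eqI, rule iffI)
    fix b assume "b \<in> (\<Union>k\<in>{..<length vs}. E k)"
    then obtain k where k: "k < length vs" "b \<in> E k" by auto
    have "\<not> us ! i \<preceq> b" if "i < length us" for i
    proof (cases "k \<le> i")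
      case True
      then show ?thesis using k that by (simp add: E)
    next
      case False
      then have "\<not> vs ! i \<preceq> b" using k that len by (simp add: E)
      then show ?thesis using div [OF that] exp_le_trans by blast
    qed
    moreover have "\<exists>v\<in>set vs. v \<preceq> b" using k by (auto simp: E)
    ultimately show "b \<in> {b. (\<exists>v\<in>set vs. v \<preceq> b) \<and> \<not> (\<exists>u\<in>set us. u \<preceq> b)}"
      by (auto simp: in_set_conv_nth)
  next
    fix b assume b: "b \<in> {b. (\<exists>v\<in>set vs. v \<preceq> b) \<and> \<not> (\<exists>u\<in>set us. u \<preceq> b)}"
    \<comment> \<open>The summand that contains \<open>b\<close> belongs to the first generator dividing it.\<close>
    define k where "k = (LEAST k. k < length vs \<and> vs ! k \<preceq> b)"
    have ex: "\<exists>k. k < length vs \<and> vs ! k \<preceq> b" using b by (auto simp: in_set_conv_nth)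
    have k: "k < length vs" "vs ! k \<preceq> b" using LeastI_ex [OF ex] by (auto simp: k_def)
    have "\<not> vs ! i \<preceq> b" if "i < k" "i < length vs" for i
      using not_less_Least [of i "\<lambda>k. k < length vs \<and> vs ! k \<preceq> b"] that by (simp add: k_def)
    then have "b \<in> E k" using k b by (auto simp: E)
    then show "b \<in> (\<Union>k\<in>{..<length vs}. E k)" using k by auto
  qed
  ultimately show ?thesis by simp
qed

lemma cone_decomposable_difference:
  fixes A B :: "('n::finite \<Rightarrow>\<^sub>0 nat) set"
  assumes A: "coprime_exponents A" and B: "coprime_exponents B"
    and sub: "monomial_ideal A \<subseteq> (monomial_ideal B :: ('n, 'k::field) mpol set)"
  shows "cone_decomposable (card (UNIV :: 'n set) - max (card A) (card B - 1))
    {b. (\<exists>v\<in>B. v \<preceq> b) \<and> \<not> (\<exists>u\<in>A. u \<preceq> b)}"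
proof -
  obtain \<sigma> where \<sigma>: "\<And>a. a \<in> A \<Longrightarrow> \<sigma> a \<in> B" "\<And>a. a \<in> A \<Longrightarrow> \<sigma> a \<preceq> a" "inj_on \<sigma> A"
    using divisor_assignment [OF A B sub] by blast
  have fin: "finite A" "finite B" using A B by (auto simp: coprime_exponents_def)
  obtain us where us: "set us = A" "distinct us" using finite_distinct_list [OF fin(1)] by blast
  obtain ws where ws: "set ws = B - \<sigma> ` A" "distinct ws"
    using finite_distinct_list [of "B - \<sigma> ` A"] fin(2) by blast
  let ?vs = "map \<sigma> us @ ws"
  have vs: "set ?vs = B" "distinct ?vs" using us ws \<sigma> by (auto simp: distinct_map)
  have len: "length us = card A" "length ?vs = card B"
    using us vs distinct_card by metis+
  have "cone_decomposable (card (UNIV :: 'n set) - max (length us) (length ?vs - 1))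
    {b. (\<exists>v\<in>set ?vs. v \<preceq> b) \<and> \<not> (\<exists>u\<in>set us. u \<preceq> b)}"
  proof (rule cone_decomposable_difference_lists)
    show "?vs ! i \<preceq> us ! i" if "i < length us" for i
      using that us(1) \<sigma>(2) nth_mem [OF that] by (simp add: nth_append)
  qed simp
  then show ?thesis unfolding len vs us .
qed

section \<open>Quotients of ideals as modules\<close>

lemma mem_coset_iff: "h \<in> I +>\<^bsub>polyring\<^esub> f \<longleftrightarrow> h - f \<in> (I :: ('n::finite, 'k::field) mpol set)"
proof -
  have "h \<in> I +>\<^bsub>polyring\<^esub> f \<longleftrightarrow> (\<exists>u\<in>I. h = u + f)"
    by (auto simp: a_r_coset_def')
  also have "\<dots> \<longleftrightarrow> h - f \<in> I"
    by (metis add_diff_cancel_right' diff_add_cancel)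
  finally show ?thesis .
qed

lemma coset_eq_iff:
  fixes I :: "('n::finite, 'k::field) mpol set"
  assumes "ideal_set I"
  shows "I +>\<^bsub>polyring\<^esub> f = I +>\<^bsub>polyring\<^esub> g \<longleftrightarrow> f - g \<in> I"
proof
  assume "I +>\<^bsub>polyring\<^esub> f = I +>\<^bsub>polyring\<^esub> g"
  then have "f \<in> I +>\<^bsub>polyring\<^esub> g"
    using ideal_set_0 [OF assms] mem_coset_iff [of f I f] by simp
  then show "f - g \<in> I" by (simp add: mem_coset_iff)
next
  assume fg: "f - g \<in> I"
  have "h - f \<in> I \<longleftrightarrow> h - g \<in> I" for h
    using ideal_set_add [OF assms, of "h - f" "f - g"] ideal_set_diff [OF assms, of "h - g" "f - g"] fg
    by auto
  then show "I +>\<^bsub>polyring\<^esub> f = I +>\<^bsub>polyring\<^esub> g" by (auto simp: mem_coset_iff)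
qed

lemma coset_zero: "I +>\<^bsub>polyring\<^esub> 0 = (I :: ('n::finite, 'k::field) mpol set)"
  by (auto simp: mem_coset_iff)

lemma coset_add:
  fixes I :: "('n::finite, 'k::field) mpol set"
  assumes "ideal_set I"
  shows "set_add polyring (I +>\<^bsub>polyring\<^esub> f) (I +>\<^bsub>polyring\<^esub> g) = I +>\<^bsub>polyring\<^esub> (f + g)"
proof (rule Set.set_eqI, rule iffI)
  fix h assume "h \<in> set_add polyring (I +>\<^bsub>polyring\<^esub> f) (I +>\<^bsub>polyring\<^esub> g)"
  then obtain u v where "u - f \<in> I" "v - g \<in> I" "h = u + v"
    by (auto simp: set_add_def' mem_coset_iff)
  moreover have "u + v - (f + g) = (u - f) + (v - g)" by simp
  ultimately show "h \<in> I +>\<^bsub>polyring\<^esub> (f + g)"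
    using ideal_set_add [OF assms] by (metis mem_coset_iff)
next
  fix h assume "h \<in> I +>\<^bsub>polyring\<^esub> (f + g)"
  then have "h - g \<in> I +>\<^bsub>polyring\<^esub> f" by (simp add: mem_coset_iff algebra_simps)
  moreover have "g \<in> I +>\<^bsub>polyring\<^esub> g" using ideal_set_0 [OF assms] by (simp add: mem_coset_iff)
  moreover have "h = (h - g) + g" by simp
  ultimately show "h \<in> set_add polyring (I +>\<^bsub>polyring\<^esub> f) (I +>\<^bsub>polyring\<^esub> g)"
    unfolding set_add_def' polyring_simps by blast
qed

lemma coset_smult:
  fixes I :: "('n::finite, 'k::field) mpol set"
  assumes "ideal_set I"
  shows "(\<Union>x\<in>I +>\<^bsub>polyring\<^esub> f. I +>\<^bsub>polyring\<^esub> (u * x)) = I +>\<^bsub>polyring\<^esub> (u * f)"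
proof -
  have "I +>\<^bsub>polyring\<^esub> (u * x) = I +>\<^bsub>polyring\<^esub> (u * f)" if "x \<in> I +>\<^bsub>polyring\<^esub> f" for x
    using ideal_set_mult [OF assms, of "x - f" u] that
    by (simp add: coset_eq_iff [OF assms] mem_coset_iff algebra_simps)
  moreover have "f \<in> I +>\<^bsub>polyring\<^esub> f" using ideal_set_0 [OF assms] by (simp add: mem_coset_iff)
  ultimately show ?thesis by blast
qed

lemma quotient_module_simps:
  fixes I :: "('n::finite, 'k::field) mpol set"
  assumes "ideal_set I"
  shows "carrier (quotient_module polyring J I) = (\<lambda>f. I +>\<^bsub>polyring\<^esub> f) ` J"
    and "(I +>\<^bsub>polyring\<^esub> f) \<oplus>\<^bsub>quotient_module polyring J I\<^esub> (I +>\<^bsub>polyring\<^esub> g) = I +>\<^bsub>polyring\<^esub> (f + g)"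
    and "\<zero>\<^bsub>quotient_module polyring J I\<^esub> = I +>\<^bsub>polyring\<^esub> 0"
    and "u \<odot>\<^bsub>quotient_module polyring J I\<^esub> (I +>\<^bsub>polyring\<^esub> f) = I +>\<^bsub>polyring\<^esub> (u * f)"
  by (simp_all add: quotient_module_def coset_add [OF assms] coset_smult [OF assms] coset_zero)

lemma abelian_monoid_quotient_module:
  fixes I :: "('n::finite, 'k::field) mpol set"
  assumes I: "ideal_set I" and J: "ideal_set J"
  shows "abelian_monoid (quotient_module polyring J I)"
  by (rule abelian_monoidI)
    (auto simp: quotient_module_simps [OF I] add.assoc add.commute add.left_commute
      intro: ideal_set_0 [OF J] ideal_set_add [OF J])

lemma finsum_quotient_module:
  fixes I :: "('n::finite, 'k::field) mpol set"
  assumes I: "ideal_set I" and J: "ideal_set J" and "finite A" and "\<And>i. i \<in> A \<Longrightarrow> f i \<in> J"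
  shows "(\<Oplus>\<^bsub>quotient_module polyring J I\<^esub>i\<in>A. I +>\<^bsub>polyring\<^esub> f i) = I +>\<^bsub>polyring\<^esub> sum f A"
proof -
  interpret M: abelian_monoid "quotient_module polyring J I"
    by (rule abelian_monoid_quotient_module [OF I J])
  show ?thesis
    using assms(3,4)
  proof (induction A rule: finite_induct)
    case empty
    then show ?case by (simp add: quotient_module_simps [OF I])
  next
    case (insert a A)
    then have "(\<lambda>i. I +>\<^bsub>polyring\<^esub> f i) \<in> A \<rightarrow> carrier (quotient_module polyring J I)"
      "I +>\<^bsub>polyring\<^esub> f a \<in> carrier (quotient_module polyring J I)"
      by (auto simp: quotient_module_simps [OF I])
    with insert show ?case by (simp add: quotient_module_simps(2) [OF I])
  qed
qed

lemma finsum_quotient_module_cong: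
  fixes I :: "('n::finite, 'k::field) mpol set"
  assumes I: "ideal_set I" and J: "ideal_set J" and "finite A"
    and "\<And>i. i \<in> A \<Longrightarrow> f i \<in> J" "\<And>i. i \<in> A \<Longrightarrow> w i = I +>\<^bsub>polyring\<^esub> f i"
  shows "(\<Oplus>\<^bsub>quotient_module polyring J I\<^esub>i\<in>A. w i) = I +>\<^bsub>polyring\<^esub> sum f A"
proof -
  interpret M: abelian_monoid "quotient_module polyring J I"
    by (rule abelian_monoid_quotient_module [OF I J])
  have "(\<Oplus>\<^bsub>quotient_module polyring J I\<^esub>i\<in>A. w i) =
    (\<Oplus>\<^bsub>quotient_module polyring J I\<^esub>i\<in>A. I +>\<^bsub>polyring\<^esub> f i)"
    by (rule M.finsum_cong') (use assms(4,5) in \<open>auto simp: quotient_module_simps [OF I]\<close>)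
  then show ?thesis using finsum_quotient_module [OF I J assms(3,4)] by simp
qed

section \<open>The depth of a quotient of monomial complete intersections\<close>

text \<open>The ideal \<open>I + (f\<^sub>0, \<dots>, f\<^bsub>k-1\<^esub>) J\<close>, the kernel of the projection of \<open>J\<close> onto
  \<open>M / (f\<^sub>0, \<dots>, f\<^bsub>k-1\<^esub>) M\<close> for \<open>M = J / I\<close>.\<close>

definition ideal_after ::
  "('a::comm_ring_1) set \<Rightarrow> 'a set \<Rightarrow> (nat \<Rightarrow> 'a) \<Rightarrow> nat \<Rightarrow> 'a set" where
  "ideal_after J I f k = {u + (\<Sum>i<k. f i * w i) | u w. u \<in> I \<and> (\<forall>i<k. w i \<in> J)}"

lemma ideal_after_0: "ideal_after J I f 0 = I"
  by (auto simp: ideal_after_def)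

lemma ideal_after_Suc:
  "ideal_after J I f (Suc k) = {u + f k * v | u v. u \<in> ideal_after J I f k \<and> v \<in> J}"
proof (rule Set.set_eqI, rule iffI)
  fix h assume "h \<in> ideal_after J I f (Suc k)"
  then obtain u w where h: "h = u + (\<Sum>i<Suc k. f i * w i)" "u \<in> I" "\<forall>i<Suc k. w i \<in> J"
    unfolding ideal_after_def by blast
  then have "u + (\<Sum>i<k. f i * w i) \<in> ideal_after J I f k"
    unfolding ideal_after_def using less_Suc_eq by blast
  moreover have "h = (u + (\<Sum>i<k. f i * w i)) + f k * w k" "w k \<in> J"
    using h by (simp_all add: add.assoc)
  ultimately show "h \<in> {u + f k * v | u v. u \<in> ideal_after J I f k \<and> v \<in> J}" by blast
next
  fix h assume "h \<in> {u + f k * v | u v. u \<in> ideal_after J I f k \<and> v \<in> J}"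
  then obtain u w v where uwv: "u \<in> I" "\<forall>i<k. w i \<in> J" "v \<in> J"
    "h = u + (\<Sum>i<k. f i * w i) + f k * v"
    unfolding ideal_after_def by blast
  then have "h = u + (\<Sum>i<Suc k. f i * (w(k := v)) i)" "\<forall>i<Suc k. (w(k := v)) i \<in> J"
    by (auto simp: add.assoc)
  then show "h \<in> ideal_after J I f (Suc k)"
    unfolding ideal_after_def using uwv(1) by blast
qed

lemma ideal_set_ideal_after:
  assumes I: "ideal_set I" and J: "ideal_set J"
  shows "ideal_set (ideal_after J I f k)"
proof (induction k)
  case 0
  then show ?case using I by (simp add: ideal_after_0)
next
  case (Suc k)
  show ?case
    unfolding ideal_set_def
  proof (intro conjI ballI allI)
    have "0 = 0 + f k * 0" by simp
    then show "0 \<in> ideal_after J I f (Suc k)"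
      unfolding ideal_after_Suc using ideal_set_0 [OF Suc] ideal_set_0 [OF J] by blast
  next
    fix x y assume "x \<in> ideal_after J I f (Suc k)" "y \<in> ideal_after J I f (Suc k)"
    then obtain u v u' v' where "x = u + f k * v" "y = u' + f k * v'"
      and *: "u \<in> ideal_after J I f k" "u' \<in> ideal_after J I f k" "v \<in> J" "v' \<in> J"
      unfolding ideal_after_Suc by blast
    then have "x + y = (u + u') + f k * (v + v')" by (simp add: algebra_simps)
    then show "x + y \<in> ideal_after J I f (Suc k)"
      unfolding ideal_after_Suc using ideal_set_add [OF Suc *(1,2)] ideal_set_add [OF J *(3,4)] by blast
  next
    fix c x assume "x \<in> ideal_after J I f (Suc k)"
    then obtain u v where "x = u + f k * v" and *: "u \<in> ideal_after J I f k" "v \<in> J"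
      unfolding ideal_after_Suc by blast
    then have "c * x = c * u + f k * (c * v)" by (simp add: algebra_simps)
    then show "c * x \<in> ideal_after J I f (Suc k)"
      unfolding ideal_after_Suc using ideal_set_mult [OF Suc *(1)] ideal_set_mult [OF J *(2)] by blast
  qed
qed

lemma coset_in_seq_submodule_iff:
  fixes I :: "('n::finite, 'k::field) mpol set"
  assumes I: "ideal_set I" and J: "ideal_set J" and k: "k \<le> length xs"
  shows "I +>\<^bsub>polyring\<^esub> f \<in> seq_submodule (quotient_module polyring J I) (take k xs) \<longleftrightarrow>
    f \<in> ideal_after J I (\<lambda>i. xs ! i) k"
proof
  let ?M = "quotient_module polyring J I"
  assume "I +>\<^bsub>polyring\<^esub> f \<in> seq_submodule ?M (take k xs)"
  then obtain v where v: "v \<in> {..<k} \<rightarrow> carrier ?M"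
    "I +>\<^bsub>polyring\<^esub> f = (\<Oplus>\<^bsub>?M\<^esub>i\<in>{..<k}. (take k xs ! i) \<odot>\<^bsub>?M\<^esub> v i)"
    using k by (auto simp: seq_submodule_def)
  have "\<forall>i\<in>{..<k}. \<exists>g. g \<in> J \<and> v i = I +>\<^bsub>polyring\<^esub> g"
    using v(1) by (auto simp: quotient_module_simps [OF I] Pi_def)
  then obtain w where w: "\<And>i. i < k \<Longrightarrow> w i \<in> J" "\<And>i. i < k \<Longrightarrow> v i = I +>\<^bsub>polyring\<^esub> w i"
    by (metis lessThan_iff)
  have "(\<Oplus>\<^bsub>?M\<^esub>i\<in>{..<k}. (take k xs ! i) \<odot>\<^bsub>?M\<^esub> v i) = I +>\<^bsub>polyring\<^esub> (\<Sum>i<k. xs ! i * w i)"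
    using w k by (intro finsum_quotient_module_cong [OF I J])
      (auto simp: quotient_module_simps [OF I] intro: ideal_set_mult [OF J])
  then have "f - (\<Sum>i<k. xs ! i * w i) \<in> I"
    using v(2) by (simp add: coset_eq_iff [OF I])
  moreover have "f = (f - (\<Sum>i<k. xs ! i * w i)) + (\<Sum>i<k. xs ! i * w i)" by simp
  ultimately show "f \<in> ideal_after J I (\<lambda>i. xs ! i) k"
    unfolding ideal_after_def using w(1) by blast
next
  let ?M = "quotient_module polyring J I"
  assume "f \<in> ideal_after J I (\<lambda>i. xs ! i) k"
  then obtain u w where u: "f = u + (\<Sum>i<k. xs ! i * w i)" "u \<in> I" and w: "\<And>i. i < k \<Longrightarrow> w i \<in> J"
    unfolding ideal_after_def by blast
  have "(\<Oplus>\<^bsub>?M\<^esub>i\<in>{..<k}. (take k xs ! i) \<odot>\<^bsub>?M\<^esub> (I +>\<^bsub>polyring\<^esub> w i)) =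
    I +>\<^bsub>polyring\<^esub> (\<Sum>i<k. xs ! i * w i)"
    using w k by (intro finsum_quotient_module_cong [OF I J])
      (auto simp: quotient_module_simps [OF I] intro: ideal_set_mult [OF J])
  moreover have "I +>\<^bsub>polyring\<^esub> f = I +>\<^bsub>polyring\<^esub> (\<Sum>i<k. xs ! i * w i)"
    using u by (simp add: coset_eq_iff [OF I])
  moreover have "(\<lambda>i. I +>\<^bsub>polyring\<^esub> w i) \<in> {..<k} \<rightarrow> carrier ?M"
    using w by (auto simp: quotient_module_simps [OF I])
  moreover have "length (take k xs) = k" using k by simp
  ultimately show "I +>\<^bsub>polyring\<^esub> f \<in> seq_submodule ?M (take k xs)"
    unfolding seq_submodule_def by (auto intro!: exI [of _ "\<lambda>i. I +>\<^bsub>polyring\<^esub> w i"])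
qed

lemma depth_le_of_not_koszul_exact:
  fixes I J :: "('n::finite, 'k::field) mpol set"
  assumes I: "ideal_set I" and J: "ideal_set J" and "inj r"
    and not_exact: "\<not> koszul_exact r var J I p"
  shows "depth (quotient_module polyring J I) \<le> enat (card (UNIV :: 'n set) - p)"
  unfolding depth_def grade_def
proof (rule SUP_least)
  let ?M = "quotient_module polyring J I"
  fix xs :: "('n, 'k) mpol list"
  assume "xs \<in> {xs. set xs \<subseteq> max_graded_ideal \<and> regular_sequence polyring ?M xs}"
  then have xs: "set xs \<subseteq> max_graded_ideal" and reg: "regular_sequence polyring ?M xs" by auto
  let ?N = "ideal_after J I (\<lambda>i. xs ! i)"
  have "\<not> card (UNIV :: 'n set) < p + length xs"
  proof
    assume len: "card (UNIV :: 'n set) < p + length xs"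
    have "koszul_exact r var J (?N 0) p"
    proof (rule koszul_exact_of_regular [where N = ?N and f = "\<lambda>i. xs ! i" and l = "length xs"])
      fix k assume "k < length xs"
      then have "xs ! k \<in> max_graded_ideal" using xs nth_mem by blast
      then show "\<exists>g. xs ! k = (\<Sum>a\<in>UNIV. g a * var a)" by (metis max_graded_idealE)
    next
      fix k v assume k: "k < length xs" and v: "v \<in> J" "xs ! k * v \<in> ?N k"
      have "\<forall>c\<in>carrier ?M. xs ! k \<odot>\<^bsub>?M\<^esub> c \<in> seq_submodule ?M (take k xs) \<longrightarrow>
        c \<in> seq_submodule ?M (take k xs)"
        using reg k by (simp add: regular_sequence_def)
      moreover have "I +>\<^bsub>polyring\<^esub> v \<in> carrier ?M" using v by (simp add: quotient_module_simps [OF I])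
      moreover have "xs ! k \<odot>\<^bsub>?M\<^esub> (I +>\<^bsub>polyring\<^esub> v) \<in> seq_submodule ?M (take k xs)"
        using v k by (simp add: quotient_module_simps [OF I] coset_in_seq_submodule_iff [OF I J])
      ultimately have "I +>\<^bsub>polyring\<^esub> v \<in> seq_submodule ?M (take k xs)" by blast
      then show "v \<in> ?N k" using k by (simp add: coset_in_seq_submodule_iff [OF I J])
    qed (rule \<open>inj r\<close> J len ideal_set_ideal_after [OF I J] ideal_after_Suc)+
    then show False using not_exact by (simp add: ideal_after_0)
  qed
  then show "enat (length xs) \<le> enat (card (UNIV :: 'n set) - p)" by simp
qed

section \<open>Stanley decompositions from partitions into cones\<close>

definition restrict_exponents :: "('n, 'k::field) mpol \<Rightarrow> ('n \<Rightarrow>\<^sub>0 nat) set \<Rightarrow> ('n, 'k) mpol" where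
  "restrict_exponents f E =
     (\<Sum>b\<in>Poly_Mapping.keys f \<inter> E. Poly_Mapping.single b (Poly_Mapping.lookup f b))"

lemma lookup_restrict_exponents:
  "Poly_Mapping.lookup (restrict_exponents f E) b = (if b \<in> E then Poly_Mapping.lookup f b else 0)"
  by (auto simp: restrict_exponents_def lookup_sum lookup_single when_def in_keys_iff)

lemma keys_restrict_exponents: "Poly_Mapping.keys (restrict_exponents f E) \<subseteq> E"
  by (auto simp: in_keys_iff lookup_restrict_exponents split: if_splits)

lemma mult_monomial_cancel:
  assumes "u * monomial a = (0 :: ('n, 'k::field) mpol)"
  shows "u = 0"
proof (rule poly_mapping_eqI)
  fix c
  have "Poly_Mapping.lookup u c = Poly_Mapping.lookup (monomial a * u) (a + c)"
    by (simp add: lookup_monomial_mult)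
  then show "Poly_Mapping.lookup u c = Poly_Mapping.lookup 0 c"
    using assms by (simp add: mult.commute)
qed

lemma subpoly_times_monomial:
  "(\<lambda>u. u * monomial (fst p)) ` subpoly (snd p) =
    {g :: ('n, 'k::field) mpol. Poly_Mapping.keys g \<subseteq> cone p}"
proof (intro equalityI subsetI)
  fix g :: "('n, 'k) mpol" assume "g \<in> (\<lambda>u. u * monomial (fst p)) ` subpoly (snd p)"
  then obtain u :: "('n, 'k) mpol" where u: "u \<in> subpoly (snd p)" "g = u * monomial (fst p)" by blast
  have "b \<in> cone p" if "b \<in> Poly_Mapping.keys g" for b
  proof -
    have "Poly_Mapping.lookup (monomial (fst p) * u) b \<noteq> 0"
      using that by (simp add: u(2) in_keys_iff mult.commute)
    then have le: "fst p \<preceq> b" and "b - fst p \<in> Poly_Mapping.keys u"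
      by (auto simp: lookup_monomial_mult in_keys_iff split: if_splits)
    then have "Poly_Mapping.keys (b - fst p) \<subseteq> snd p" using u(1) by (auto simp: subpoly_def)
    then have "Poly_Mapping.lookup b i - Poly_Mapping.lookup (fst p) i = 0" if "i \<notin> snd p" for i
      using that unfolding lookup_minus [symmetric] in_keys_iff subset_iff by blast
    then show ?thesis using le by (auto simp: cone_def exp_le_def intro: le_antisym)
  qed
  then show "g \<in> {g. Poly_Mapping.keys g \<subseteq> cone p}" by blast
next
  fix g :: "('n, 'k) mpol" assume "g \<in> {g. Poly_Mapping.keys g \<subseteq> cone p}"
  then have g: "Poly_Mapping.keys g \<subseteq> cone p" by simp
  define u where "u = (\<Sum>b\<in>Poly_Mapping.keys g. Poly_Mapping.single (b - fst p) (Poly_Mapping.lookup g b))"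
  have "u * monomial (fst p) = (\<Sum>b\<in>Poly_Mapping.keys g. Poly_Mapping.single b (Poly_Mapping.lookup g b))"
    unfolding u_def sum_distrib_right
  proof (rule sum.cong)
    fix b assume "b \<in> Poly_Mapping.keys g"
    then have "fst p \<preceq> b" using g by (auto simp: cone_def)
    then show "Poly_Mapping.single (b - fst p) (Poly_Mapping.lookup g b) * monomial (fst p) =
        Poly_Mapping.single b (Poly_Mapping.lookup g b)"
      by (simp add: monomial_def mult_single add.commute [of "b - fst p"] exp_le_diff_add)
  qed simp
  then have "g = u * monomial (fst p)" using sum_single_lookup [of g] by simp
  moreover have "u \<in> subpoly (snd p)"
    unfolding subpoly_def
  proof safe
    fix c i assume "c \<in> Poly_Mapping.keys u" "i \<in> Poly_Mapping.keys c"
    then have "(\<Sum>b\<in>Poly_Mapping.keys g. Poly_Mapping.lookup g b when b - fst p = c) \<noteq> 0"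
      by (simp add: u_def in_keys_iff lookup_sum lookup_single)
    then obtain b where "b \<in> Poly_Mapping.keys g"
      "(Poly_Mapping.lookup g b when b - fst p = c) \<noteq> 0"
      by (rule sum.not_neutral_contains_not_neutral)
    then have b: "b \<in> cone p" "b - fst p = c" using g by auto
    then have "Poly_Mapping.lookup b i \<noteq> Poly_Mapping.lookup (fst p) i"
      using \<open>i \<in> Poly_Mapping.keys c\<close> by (auto simp: in_keys_iff lookup_minus)
    then show "i \<in> snd p" using b(1) by (auto simp: cone_def)
  qed
  ultimately show "g \<in> (\<lambda>u. u * monomial (fst p)) ` subpoly (snd p)" by blast
qed

text \<open>A partition of the monomials in \<open>J\<close> but not in \<open>I\<close> into cones gives a Stanley decomposition, because
  these monomials represent a basis of \<open>J/I\<close>: the components of the class of \<open>f\<close> are the classes of its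
  restrictions to the cones.\<close>

lemma stanley_decomposition_of_cones:
  fixes A B :: "('n::finite \<Rightarrow>\<^sub>0 nat) set"
  defines "I \<equiv> monomial_ideal A :: ('n, 'k::field) mpol set" and "J \<equiv> monomial_ideal B"
  assumes "distinct ps" and part: "cone_partition (set ps) {b. (\<exists>v\<in>B. v \<preceq> b) \<and> \<not> (\<exists>u\<in>A. u \<preceq> b)}"
  shows "stanley_decomposition (quotient_module polyring J I) (quotient_component J I)
    (map (\<lambda>p. (I +>\<^bsub>polyring\<^esub> monomial (fst p), snd p)) ps)"
proof -
  let ?M = "quotient_module polyring J I" and ?n = "length ps"
  let ?\<pi> = "\<lambda>f. I +>\<^bsub>polyring\<^esub> f" and ?D = "map (\<lambda>p. (I +>\<^bsub>polyring\<^esub> monomial (fst p), snd p)) ps"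
  have I: "ideal_set I" and J: "ideal_set J"
    unfolding I_def J_def by (rule ideal_set_monomial_ideal)+
  have cone_E: "(\<exists>v\<in>B. v \<preceq> b) \<and> \<not> (\<exists>u\<in>A. u \<preceq> b)" if "p \<in> set ps" "b \<in> cone p" for p b
    using part that unfolding cone_partition_def by blast
  have in_J: "g \<in> J" if "p \<in> set ps" "Poly_Mapping.keys g \<subseteq> cone p" for g p
    using cone_E [OF that(1)] that(2) by (auto simp: J_def monomial_ideal_def)
  have unique: "i = j" if "i < ?n" "j < ?n" "b \<in> cone (ps ! i)" "b \<in> cone (ps ! j)" for i j b
  proof (rule ccontr)
    assume "i \<noteq> j"
    then have "ps ! i \<noteq> ps ! j" using \<open>distinct ps\<close> that by (simp add: nth_eq_iff_index_eq)
    then have "cone (ps ! i) \<inter> cone (ps ! j) = {}"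
      using part that by (simp add: cone_partition_def disjoint_family_on_def)
    then show False using that by blast
  qed
  have space: "stanley_space ?M (?D ! i) = ?\<pi> ` {g. Poly_Mapping.keys g \<subseteq> cone (ps ! i)}"
    if "i < ?n" for i
    using that subpoly_times_monomial [of "ps ! i", where 'k = 'k, symmetric]
    by (simp add: stanley_space_def quotient_module_simps [OF I] image_image)
  have sum_lookup: "Poly_Mapping.lookup (\<Sum>j<?n. g j) b = Poly_Mapping.lookup (g i) b"
    if g: "\<And>j. j < ?n \<Longrightarrow> Poly_Mapping.keys (g j) \<subseteq> cone (ps ! j)" and "i < ?n" "b \<in> cone (ps ! i)"
    for g :: "nat \<Rightarrow> ('n, 'k) mpol" and i b
  proof -
    have "Poly_Mapping.lookup (g j) b = (if j = i then Poly_Mapping.lookup (g i) b else 0)"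
      if "j < ?n" for j
      using unique [OF that \<open>i < ?n\<close> _ \<open>b \<in> cone (ps ! i)\<close>] g [OF that] by (auto simp: in_keys_iff)
    then have "Poly_Mapping.lookup (\<Sum>j<?n. g j) b =
      (\<Sum>j<?n. if j = i then Poly_Mapping.lookup (g i) b else 0)"
      unfolding lookup_sum by (intro sum.cong) auto
    then show ?thesis using \<open>i < ?n\<close> by simp
  qed
  have unique_sum: "\<exists>!w. w \<in> (\<Pi>\<^sub>E i\<in>{..<?n}. stanley_space ?M (?D ! i)) \<and>
      ?\<pi> f = (\<Oplus>\<^bsub>?M\<^esub>i\<in>{..<?n}. w i)" if f: "f \<in> J" for f
  proof -
    let ?g = "\<lambda>i. restrict_exponents f (cone (ps ! i))"
    let ?w = "\<lambda>i\<in>{..<?n}. ?\<pi> (?g i)"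
    have "Poly_Mapping.lookup (f - (\<Sum>i<?n. ?g i)) b = 0"
      if nA: "\<not> (\<exists>u\<in>A. u \<preceq> b)" for b
    proof (cases "\<exists>v\<in>B. v \<preceq> b")
      case True
      then have "b \<in> (\<Union>p\<in>set ps. cone p)" using part nA by (simp add: cone_partition_def)
      then obtain i where i: "i < ?n" "b \<in> cone (ps ! i)" by (auto simp: in_set_conv_nth)
      then show ?thesis
        using sum_lookup [of ?g, OF keys_restrict_exponents i]
        by (simp add: lookup_minus lookup_restrict_exponents)
    next
      case False
      then have "Poly_Mapping.lookup f b = 0" using f by (auto simp: J_def intro: lookup_monomial_ideal)
      then show ?thesis
        by (auto simp: lookup_minus lookup_sum lookup_restrict_exponents intro!: sum.neutral)
    qed
    then have "f - (\<Sum>i<?n. ?g i) \<in> I"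
      unfolding I_def monomial_ideal_def in_keys_iff by blast
    moreover have "(\<Oplus>\<^bsub>?M\<^esub>i\<in>{..<?n}. ?w i) = ?\<pi> (\<Sum>i<?n. ?g i)"
      by (rule finsum_quotient_module_cong [OF I J])
        (auto intro: in_J [OF nth_mem keys_restrict_exponents])
    ultimately have sum: "?\<pi> f = (\<Oplus>\<^bsub>?M\<^esub>i\<in>{..<?n}. ?w i)"
      by (simp add: coset_eq_iff [OF I])
    show ?thesis
    proof (rule ex1I [of _ ?w], rule conjI)
      show "?w \<in> (\<Pi>\<^sub>E i\<in>{..<?n}. stanley_space ?M (?D ! i))"
      proof (rule restrict_PiE_iff [THEN iffD2], rule ballI)
        fix i assume "i \<in> {..<?n}"
        then have "i < ?n" by simp
        show "?\<pi> (?g i) \<in> stanley_space ?M (?D ! i)"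
          unfolding space [OF \<open>i < ?n\<close>] using keys_restrict_exponents by (intro imageI CollectI)
      qed
    next
      fix w assume w: "w \<in> (\<Pi>\<^sub>E i\<in>{..<?n}. stanley_space ?M (?D ! i)) \<and>
        ?\<pi> f = (\<Oplus>\<^bsub>?M\<^esub>i\<in>{..<?n}. w i)"
      have "\<exists>g. Poly_Mapping.keys g \<subseteq> cone (ps ! i) \<and> w i = ?\<pi> g" if "i < ?n" for i
      proof -
        have "w i \<in> stanley_space ?M (?D ! i)" using w that by (auto dest!: PiE_mem)
        then show ?thesis unfolding space [OF that] by blast
      qed
      then obtain g where g: "\<And>i. i < ?n \<Longrightarrow> Poly_Mapping.keys (g i) \<subseteq> cone (ps ! i)"
        "\<And>i. i < ?n \<Longrightarrow> w i = ?\<pi> (g i)" by metis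
      have "(\<Oplus>\<^bsub>?M\<^esub>i\<in>{..<?n}. w i) = ?\<pi> (\<Sum>i<?n. g i)"
        by (rule finsum_quotient_module_cong [OF I J])
          (use g in \<open>auto intro: in_J [OF nth_mem]\<close>)
      then have diff: "f - (\<Sum>i<?n. g i) \<in> I" using w by (simp add: coset_eq_iff [OF I])
      have "g i = ?g i" if "i < ?n" for i
      proof (rule poly_mapping_eqI)
        fix b
        show "Poly_Mapping.lookup (g i) b = Poly_Mapping.lookup (?g i) b"
        proof (cases "b \<in> cone (ps ! i)")
          case True
          then have "Poly_Mapping.lookup (f - (\<Sum>i<?n. g i)) b = 0"
            using cone_E [OF nth_mem [OF that]] diff by (auto simp: I_def intro: lookup_monomial_ideal)
          then show ?thesis
            using sum_lookup [of g, OF g(1) that True] True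
            by (simp add: lookup_minus lookup_restrict_exponents)
        next
          case False
          then have "b \<notin> Poly_Mapping.keys (g i)" using g(1) [OF that] by blast
          then show ?thesis using False by (simp add: lookup_restrict_exponents in_keys_iff)
        qed
      qed
      then have "w i = ?w i" if "i \<in> {..<?n}" for i using g(2) that by simp
      moreover have "w \<in> extensional {..<?n}" using w by (auto simp: PiE_def)
      ultimately show "w = ?w" by (intro extensionalityI [of w "{..<?n}"]) auto
    qed (rule sum)
  qed
  show ?thesis
    unfolding stanley_decomposition_def
  proof (intro conjI)
    show "\<forall>(m, Z)\<in>set ?D. m \<in> carrier ?M \<and> (\<exists>a. m \<in> quotient_component J I a)"
    proof clarify
      fix m Z assume "(m, Z) \<in> set ?D"
      then obtain p where p: "p \<in> set ps" "m = ?\<pi> (monomial (fst p))" by auto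
      then have mono: "monomial (fst p) \<in> J" using in_J [OF p(1)] cone_nonempty [of p] by simp
      moreover have "monomial (fst p) \<in> poly_component (\<lambda>i. int (Poly_Mapping.lookup (fst p) i))"
        by (simp add: poly_component_def)
      ultimately have "m \<in> quotient_component J I (\<lambda>i. int (Poly_Mapping.lookup (fst p) i))"
        unfolding quotient_component_def p(2) by (intro imageI IntI)
      then show "m \<in> carrier ?M \<and> (\<exists>a. m \<in> quotient_component J I a)"
        using mono p(2) by (auto simp: quotient_module_simps [OF I])
    qed
    show "\<forall>(m, Z)\<in>set ?D. \<forall>u\<in>subpoly Z. u \<odot>\<^bsub>?M\<^esub> m = \<zero>\<^bsub>?M\<^esub> \<longrightarrow> u = 0"
    proof clarify
      fix m Z and u :: "('n, 'k) mpol"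
      assume "(m, Z) \<in> set ?D" "u \<in> subpoly Z" and zero: "u \<odot>\<^bsub>?M\<^esub> m = \<zero>\<^bsub>?M\<^esub>"
      then obtain p where p: "p \<in> set ps" "m = ?\<pi> (monomial (fst p))" "u \<in> subpoly (snd p)" by auto
      then have "u * monomial (fst p) \<in> I"
        using zero by (simp add: quotient_module_simps [OF I] coset_eq_iff [OF I])
      moreover have "Poly_Mapping.keys (u * monomial (fst p)) \<subseteq> cone p"
        using subpoly_times_monomial [of p, where 'k = 'k] p(3) by blast
      ultimately have "Poly_Mapping.keys (u * monomial (fst p)) = {}"
        using cone_E [OF p(1)] unfolding I_def monomial_ideal_def by blast
      then have "u * monomial (fst p) = 0"
        by (intro poly_mapping_eqI) (simp flip: not_in_keys_iff_lookup_eq_zero)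
      then show "u = 0" by (rule mult_monomial_cancel)
    qed
    show "\<forall>v\<in>carrier ?M. \<exists>!w. w \<in> (\<Pi>\<^sub>E i\<in>{..<length ?D}. stanley_space ?M (?D ! i)) \<and>
        v = (\<Oplus>\<^bsub>?M\<^esub>i\<in>{..<length ?D}. w i)"
      using unique_sum by (simp add: quotient_module_simps(1) [OF I])
  qed
qed

text \<open>The maximum over all decompositions is meaningful because each value is at most the number of
  variables, apart from the arbitrary value that the minimum has for an empty list.\<close>

lemma sdepth_ge:
  fixes M :: "(('n::finite, 'k::field) mpol, 'm, 'c) module_scheme"
  assumes D: "stanley_decomposition M gr D" "D \<noteq> []" and d: "\<And>m Z. (m, Z) \<in> set D \<Longrightarrow> d \<le> card Z"
  shows "d \<le> sdepth M gr"
proof -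
  let ?S = "{sdepth_decomposition D | D. stanley_decomposition M gr D}"
  have "sdepth_decomposition D' \<le> card (UNIV :: 'n set)" if "D' \<noteq> []" for D' :: "('m \<times> 'n set) list"
  proof -
    obtain m Z where "hd D' = (m, Z)" by fastforce
    then have "(m, Z) \<in> set D'" using that hd_in_set by metis
    then have "sdepth_decomposition D' \<le> card Z"
      unfolding sdepth_decomposition_def by (intro Min_le) force+
    also have "\<dots> \<le> card (UNIV :: 'n set)" by (simp add: card_mono)
    finally show ?thesis .
  qed
  then have "sdepth_decomposition D' \<in>
      insert (sdepth_decomposition ([] :: ('m \<times> 'n set) list)) {..card (UNIV :: 'n set)}"
    for D' :: "('m \<times> 'n set) list"
    by (cases "D' = []") simp_all
  then have "?S \<subseteq> insert (sdepth_decomposition ([] :: ('m \<times> 'n set) list)) {..card (UNIV :: 'n set)}"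
    by blast
  then have "finite ?S" by (rule finite_subset) simp
  then have "sdepth_decomposition D \<le> sdepth M gr"
    unfolding sdepth_def using D(1) by (intro Max_ge) auto
  moreover have "d \<le> sdepth_decomposition D"
    unfolding sdepth_decomposition_def using D(2) d by (intro Min.boundedI) auto
  ultimately show ?thesis by simp
qed

lemma sdepth_ge_of_cone_decomposable:
  fixes A B :: "('n::finite \<Rightarrow>\<^sub>0 nat) set"
  assumes sub: "monomial_ideal A \<subset> (monomial_ideal B :: ('n, 'k::field) mpol set)"
    and dec: "cone_decomposable d {b. (\<exists>v\<in>B. v \<preceq> b) \<and> \<not> (\<exists>u\<in>A. u \<preceq> b)}"
  shows "d \<le> sdepth (quotient_module polyring (monomial_ideal B) (monomial_ideal A :: ('n, 'k) mpol set))
    (quotient_component (monomial_ideal B) (monomial_ideal A))"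
proof -
  obtain C where C: "cone_partition C {b. (\<exists>v\<in>B. v \<preceq> b) \<and> \<not> (\<exists>u\<in>A. u \<preceq> b)}"
    "\<And>p. p \<in> C \<Longrightarrow> d \<le> card (snd p)"
    using dec unfolding cone_decomposable_def by blast
  have "finite C" using C(1) by (simp add: cone_partition_def)
  then obtain ps where ps: "set ps = C" "distinct ps"
    using finite_distinct_list by blast
  have "\<exists>f\<in>monomial_ideal B. f \<notin> (monomial_ideal A :: ('n, 'k) mpol set)" using sub by blast
  then have "{b. (\<exists>v\<in>B. v \<preceq> b) \<and> \<not> (\<exists>u\<in>A. u \<preceq> b)} \<noteq> {}"
    unfolding monomial_ideal_def by blast
  then have "ps \<noteq> []" using C(1) ps(1) unfolding cone_partition_def by fastforce
  show ?thesis
  proof (rule sdepth_ge [OF stanley_decomposition_of_cones [OF ps(2) C(1) [folded ps(1)]]])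
    show "map (\<lambda>p. (monomial_ideal A +>\<^bsub>polyring\<^esub> monomial (fst p), snd p)) ps \<noteq> []"
      using \<open>ps \<noteq> []\<close> by simp
  qed (use C(2) ps(1) in auto)
qed

theorem corollary2p6:
  fixes I J :: "('n::finite, 'k::field) mpol set"
  assumes "monomial_complete_intersection I"
    and "monomial_complete_intersection J"
    and "I \<subset> J"
  shows "enat (sdepth (quotient_module polyring J I) (quotient_component J I))
           \<ge> depth (quotient_module polyring J I)"
proof -
  obtain A where A: "coprime_exponents A" "I = monomial_ideal A"
    using monomial_complete_intersectionE [OF assms(1)] .
  obtain B where B: "coprime_exponents B" "J = monomial_ideal B"
    using monomial_complete_intersectionE [OF assms(2)] .
  let ?c = "max (card A) (card B - 1)"
  have sub: "monomial_ideal A \<subset> (monomial_ideal B :: ('n, 'k) mpol set)"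
    using assms(3) A(2) B(2) by simp
  obtain r where r: "inj r" "\<not> koszul_exact r var J I ?c"
    using not_koszul_exact_monomial_ideals [OF A(1) B(1) sub] A(2) B(2) by blast
  have "depth (quotient_module polyring J I) \<le> enat (card (UNIV :: 'n set) - ?c)"
    by (rule depth_le_of_not_koszul_exact [OF _ _ r])
      (simp_all add: A(2) B(2) ideal_set_monomial_ideal)
  also have "\<dots> \<le> enat (sdepth (quotient_module polyring J I) (quotient_component J I))"
    using sdepth_ge_of_cone_decomposable [OF sub
        cone_decomposable_difference [OF A(1) B(1) psubset_imp_subset [OF sub]]]
    by (simp add: A(2) B(2))
  finally show ?thesis .
qed

end
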